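(* Let $W$ be a plane graph that is a subdivision of a wheel $W_n$ ($n\ge3$), embedded as the wheel. Then $\pi_{fl}(W)\le 8$.
   Context: The wheel $W_n$ is obtained by joining a central vertex to all $n$ vertices of a cycle. A sequence $r_1\dots r_{2n}$ is a repetition if $r_i=r_{n+i}$ for all $i\le n$. In a plane graph $G$, a facial path is a path whose vertices and edges are consecutive on the boundary walk of some face of $G$. A vertex colouring is facial non-repetitive if no facial path on vertices $v_1,\dots,v_{2n}$ ($n\ge1$) has colour sequence that is a repetition. $\pi_{fl}(G)$ is the minimum $l$ such that for every assignment of lists $L(v)\subseteq\mathbb{Z}_+$ with $|L(v)|\ge l$ there is a facial non-repetitive colouring $\varphi$ with $\varphi(v)\in L(v)$ for every vertex $v$. *)

theory Defs
  imports "Graph_Theory.Graph_Theory" "HOL-Combinatorics.Orbits"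
begin

section \<open>Plane graphs\<close>

text \<open>
  A plane graph is represented by its combinatorial map (rotation system): a finite simple graph,
  given as a symmetric loop-free set of darts \<open>(u, v)\<close>, together with a permutation \<open>rot\<close> of the
  darts that sends \<open>(u, v)\<close> to the next dart leaving \<open>u\<close> in counterclockwise order.
  After traversing the dart \<open>(u, v)\<close>, the walk around the face on its right continues with the
  dart following \<open>(v, u)\<close> in the rotation at \<open>v\<close>; the orbits of \<open>face_succ\<close> are the boundary walks
  of the faces.
\<close>

definition face_succ :: "('a \<times> 'a \<Rightarrow> 'a \<times> 'a) \<Rightarrow> 'a \<times> 'a \<Rightarrow> 'a \<times> 'a" where
  "face_succ rot d = rot (prod.swap d)"

definition boundary_walks ::
    "'a pair_pre_digraph \<Rightarrow> ('a \<times> 'a \<Rightarrow> 'a \<times> 'a) \<Rightarrow> ('a \<times> 'a) set set" where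
  "boundary_walks G rot = orbit (face_succ rot) ` parcs G"

definition isolated_vertices :: "'a pair_pre_digraph \<Rightarrow> 'a set" where
  "isolated_vertices G = {v \<in> pverts G. out_arcs (with_proj G) v = {}}"

text \<open>
  Planarity is Euler's formula, \<open>V - E + F = 2\<close> for every connected component, summed over the
  components. An isolated vertex has a trivial boundary walk, which is not an orbit of darts and is
  therefore counted separately.
\<close>

locale plane_graph = pair_graph G for G :: "'a pair_pre_digraph" +
  fixes rot :: "'a \<times> 'a \<Rightarrow> 'a \<times> 'a"
  assumes rot_permutes: "rot permutes parcs G"
    and rot_cyclic: "\<And>v. v \<in> pverts G \<Longrightarrow> out_arcs (with_proj G) v \<noteq> {} \<Longrightarrow>
      cyclic_on rot (out_arcs (with_proj G) v)"
    and euler: "card (pverts G) + (card (boundary_walks G rot) + card (isolated_vertices G))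
      = card (parcs G) div 2 + 2 * card (pre_digraph.sccs_verts (with_proj G))"


section \<open>Facial non-repetitive list colouring\<close>

definition repetition :: "'c list \<Rightarrow> bool" where
  "repetition r \<longleftrightarrow> (\<exists>n\<ge>1. length r = 2 * n \<and> (\<forall>i<n. r ! i = r ! (n + i)))"

text \<open>
  The \<open>k\<close> consecutive vertices met by the boundary walk that starts with the dart \<open>d\<close>. In a simple
  graph they determine the edges traversed.
\<close>

definition boundary_segment ::
    "('a \<times> 'a \<Rightarrow> 'a \<times> 'a) \<Rightarrow> 'a \<times> 'a \<Rightarrow> nat \<Rightarrow> 'a list" where
  "boundary_segment rot d k = map (\<lambda>i. fst ((face_succ rot ^^ i) d)) [0..<k]"

text \<open>A path has no direction, so its vertices may be listed along or against the boundary walk.\<close>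

definition facial_path ::
    "'a pair_pre_digraph \<Rightarrow> ('a \<times> 'a \<Rightarrow> 'a \<times> 'a) \<Rightarrow> 'a list \<Rightarrow> bool" where
  "facial_path G rot p \<longleftrightarrow> p \<noteq> [] \<and> distinct p \<and>
    (\<exists>d\<in>parcs G. p = boundary_segment rot d (length p)
                \<or> rev p = boundary_segment rot d (length p))"

definition facial_nonrepetitive ::
    "'a pair_pre_digraph \<Rightarrow> ('a \<times> 'a \<Rightarrow> 'a \<times> 'a) \<Rightarrow> ('a \<Rightarrow> 'c) \<Rightarrow> bool" where
  "facial_nonrepetitive G rot \<phi> \<longleftrightarrow> (\<forall>p. facial_path G rot p \<longrightarrow> \<not> repetition (map \<phi> p))"

text \<open>Infinite lists are admitted; their cardinality exceeds every \<open>l\<close>, whereas \<open>card\<close> is then 0.\<close>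

definition facially_nonrepetitively_choosable ::
    "'a pair_pre_digraph \<Rightarrow> ('a \<times> 'a \<Rightarrow> 'a \<times> 'a) \<Rightarrow> nat \<Rightarrow> bool" where
  "facially_nonrepetitively_choosable G rot l \<longleftrightarrow>
    (\<forall>L :: 'a \<Rightarrow> nat set.
      (\<forall>v\<in>pverts G. L v \<subseteq> {1..} \<and> (infinite (L v) \<or> l \<le> card (L v))) \<longrightarrow>
      (\<exists>\<phi>. (\<forall>v\<in>pverts G. \<phi> v \<in> L v) \<and> facial_nonrepetitive G rot \<phi>))"

definition pi_fl :: "'a pair_pre_digraph \<Rightarrow> ('a \<times> 'a \<Rightarrow> 'a \<times> 'a) \<Rightarrow> nat" where
  "pi_fl G rot = (LEAST l. facially_nonrepetitively_choosable G rot l)"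


section \<open>Wheels and their subdivisions\<close>

definition wheel_graph :: "nat \<Rightarrow> 'a \<Rightarrow> (nat \<Rightarrow> 'a) \<Rightarrow> 'a pair_pre_digraph" where
  "wheel_graph n c r = \<lparr> pverts = insert c (r ` {..<n}),
     parcs = (\<Union>i<n. {(c, r i), (r i, c),
                       (r i, r (Suc i mod n)), (r (Suc i mod n), r i)}) \<rparr>"

text \<open>
  The drawing of \<open>W\<^sub>n\<close> with the centre \<open>c\<close> inside the rim \<open>r 0, r 1, \<dots>, r (n - 1)\<close>, the rim being
  numbered counterclockwise. The mirror image arises by numbering the rim backwards.
\<close>

definition plane_wheel ::
    "nat \<Rightarrow> 'a pair_pre_digraph \<Rightarrow> ('a \<times> 'a \<Rightarrow> 'a \<times> 'a) \<Rightarrow> bool" where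
  "plane_wheel n G rot \<longleftrightarrow> (\<exists>c r. inj_on r {..<n} \<and> c \<notin> r ` {..<n} \<and>
     G = wheel_graph n c r \<and> rot permutes parcs G \<and>
     (\<forall>i<n. let next_r = r (Suc i mod n); prev_r = r ((i + n - 1) mod n) in
        rot (c, r i) = (c, next_r) \<and>
        rot (r i, next_r) = (r i, c) \<and>
        rot (r i, c) = (r i, prev_r) \<and>
        rot (r i, prev_r) = (r i, next_r)))"

text \<open>
  Placing a new vertex \<open>w\<close> on the edge \<open>uv\<close> of a plane graph: the dart \<open>(u, w)\<close> takes the place of
  \<open>(u, v)\<close> in the rotation at \<open>u\<close>, the dart \<open>(v, w)\<close> takes the place of \<open>(v, u)\<close> in the rotation at
  \<open>v\<close>, and \<open>(w, u)\<close>, \<open>(w, v)\<close> form the rotation at \<open>w\<close>.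
\<close>

fun subdivide_rot ::
    "('a \<times> 'a \<Rightarrow> 'a \<times> 'a) \<Rightarrow> 'a \<times> 'a \<Rightarrow> 'a \<Rightarrow> 'a \<times> 'a \<Rightarrow> 'a \<times> 'a" where
  "subdivide_rot rot (u, v) w =
     (let rename = Transposition.transpose (u, v) (u, w) \<circ> Transposition.transpose (v, u) (v, w)
      in Transposition.transpose (w, u) (w, v) \<circ> rename \<circ> rot \<circ> rename)"

inductive plane_subdivision ::
    "'a pair_pre_digraph \<Rightarrow> ('a \<times> 'a \<Rightarrow> 'a \<times> 'a) \<Rightarrow>
     'a pair_pre_digraph \<Rightarrow> ('a \<times> 'a \<Rightarrow> 'a \<times> 'a) \<Rightarrow> bool"
  for G rot where
    base: "pair_bidirected_digraph G \<Longrightarrow> plane_subdivision G rot G rot"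
  | divide: "plane_subdivision G rot H rotH \<Longrightarrow> e \<in> parcs H \<Longrightarrow> w \<notin> pverts H \<Longrightarrow>
      plane_subdivision G rot (subdivide H e w) (subdivide_rot rotH e w)"

lemma plane_subdivision_imp_subdivision:
  "plane_subdivision G rot H rotH \<Longrightarrow> subdivision_pair G H"
  by (induction rule: plane_subdivision.induct) (auto intro: subdivision_pair_intros)

end

theory Submission
  imports Defs "HOL-Library.Sublist" "HOL-Library.Multiset"
begin

text \<open>
  Three kinds of reserved colours break every facial cycle into paths on which at least four colours
  per list survive, and lists of size four suffice for a path by Rosenfeld's counting argument. The
  colour \<open>\<alpha>\<close> of the centre is used nowhere else, and the colour \<open>\<gamma>\<close> of the rim vertex \<open>r 0\<close> nowhere
  else on the rim or on the two inner faces at \<open>r 0\<close>. On every other spoke the neighbour of the rim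
  vertex \<open>r i\<close> gets a colour \<open>\<eta> i\<close> that is avoided by the rest of the two inner faces at its spoke,
  except that \<open>r (i - 1)\<close> may also have it; otherwise \<open>r i\<close> would lose five colours. A square that
  uses this exception would match \<open>r (i - 1)\<close> with the neighbour of \<open>r i\<close>, hence \<open>r i\<close> with another
  vertex of its own spoke, and these avoid the colour of \<open>r i\<close>.
\<close>

section \<open>Non-repetitive words\<close>

text \<open>The bound 8 is 4 + 4: the counting argument uses up four colours per list, so each
  vertex can afford four forbidden ones. The faces cannot be coloured one at a time, because a spoke
  lies on two inner faces and a rim path on an inner face and the outer one. So only the rim opened
  at \<open>r 0\<close> and the spokes are coloured by the path argument, and every face is glued
  from pieces of these at reserved colours. The gluing is asymmetric. Away from \<open>r 0\<close>,
  the face between spokes \<open>i\<close> and \<open>i + 1\<close> is cut at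
  \<open>\<eta> i\<close>, which occurs at most once on it, and only the part beyond spoke
  \<open>i\<close> is then cut at \<open>\<eta> (i + 1)\<close>. So spoke \<open>i\<close> does not
  have to avoid \<open>\<eta> (i + 1)\<close>, and the place saved goes to the colour of
  \<open>r i\<close>: the vertices of the spoke other than its last are denied \<alpha>,
  \<open>\<eta> (i - 1)\<close>, \<open>\<eta> i\<close> and the colour of
  \<open>r i\<close>.\<close>

lemma repetition_iff: "repetition r \<longleftrightarrow> (\<exists>x. x \<noteq> [] \<and> r = x @ x)"
proof
  assume "repetition r"
  then obtain n where n: "n \<ge> 1" "length r = 2 * n" "\<forall>i<n. r ! i = r ! (n + i)"
    unfolding repetition_def by auto
  have "drop n r = take n r"
    by (rule nth_equalityI) (use n in auto)
  then show "\<exists>x. x \<noteq> [] \<and> r = x @ x"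
    using n by (intro exI[of _ "take n r"]) (auto, metis append_take_drop_id)
next
  assume "\<exists>x. x \<noteq> [] \<and> r = x @ x"
  then obtain x where "x \<noteq> []" "r = x @ x" by blast
  then show "repetition r"
    unfolding repetition_def
    by (intro exI[of _ "length x"]) (auto simp: nth_append Suc_le_eq)
qed

lemma repetition_rev [simp]: "repetition (rev r) \<longleftrightarrow> repetition r"
  unfolding repetition_iff by (metis rev_append rev_is_Nil_conv rev_rev_ident)

definition nonrep :: "'c list \<Rightarrow> bool" where
  "nonrep w \<longleftrightarrow> (\<forall>s. sublist s w \<longrightarrow> \<not> repetition s)"

lemma nonrep_rev [simp]: "nonrep (rev w) \<longleftrightarrow> nonrep w"
  unfolding nonrep_def by (metis repetition_rev rev_rev_ident sublist_rev)

lemma nonrep_sublist: "nonrep w \<Longrightarrow> sublist s w \<Longrightarrow> nonrep s"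
  unfolding nonrep_def by (meson sublist_order.order.trans)

lemma nonrep_Nil [simp]: "nonrep []"
  by (simp add: nonrep_def repetition_iff)

lemma sublist_append_Cons_cases:
  assumes "sublist s (A @ y # B)"
  shows "sublist s A \<or> sublist s B \<or> y \<in> set s"
proof -
  from assms consider "sublist s A" | "sublist s (y # B)"
    | xs1 xs2 where "s = xs1 @ xs2" "suffix xs1 A" "prefix xs2 (y # B)"
    unfolding sublist_append by blast
  then show ?thesis
  proof cases
    case 2
    then show ?thesis by (auto simp: sublist_Cons_right prefix_Cons)
  next
    case 3
    then show ?thesis by (auto simp: prefix_Cons)
  qed simp
qed

lemma repetition_count_list:
  assumes "repetition s" "y \<in> set s"
  shows "count_list s y \<ge> 2"
proof -
  obtain x where "s = x @ x" using assms(1) repetition_iff by blast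
  then show ?thesis using assms(2) count_list_0_iff[of x y] by simp
qed

text \<open>Every colour of a square occurs in it at least twice, so no square contains the single
  \<open>y\<close>. This is how path pieces are glued at a reserved colour.\<close>

lemma nonrep_append_unique:
  assumes "nonrep A" "nonrep B" "y \<notin> set A" "y \<notin> set B"
  shows "nonrep (A @ y # B)"
  unfolding nonrep_def
proof (intro allI impI notI)
  fix s
  assume s: "sublist s (A @ y # B)" "repetition s"
  with assms have "y \<in> set s"
    using sublist_append_Cons_cases[of s A y B] unfolding nonrep_def by blast
  then have "count_list s y \<ge> 2"
    by (rule repetition_count_list[OF s(2)])
  moreover obtain p q where "A @ y # B = p @ s @ q"
    using s(1) unfolding sublist_def by blast
  then have "count_list (A @ y # B) y = count_list p y + count_list s y + count_list q y"
    by simp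
  ultimately show False
    using assms(3,4) count_list_0_iff[of A y] count_list_0_iff[of B y] by simp
qed

text \<open>
  Rosenfeld's counting: a bad extension of a good word of length \<open>m\<close> ends in a square \<open>x @ x\<close> and is
  determined by the good word that remains when the last \<open>x\<close> is removed. So the number \<open>g\<close> of good
  words satisfies \<open>g (m + 1) \<ge> 4 * g m - (g 0 + \<dots> + g m)\<close>, and by induction the bracket is at most
  \<open>2 * g m\<close>.
\<close>

definition good_words :: "(nat \<Rightarrow> 'c set) \<Rightarrow> nat \<Rightarrow> 'c list set" where
  "good_words A m = {w. length w = m \<and> (\<forall>i<m. w ! i \<in> A i) \<and> nonrep w}"

lemma finite_good_words:
  assumes "\<And>i. finite (A i)"
  shows "finite (good_words A m)"
proof (rule finite_subset)
  show "good_words A m \<subseteq> {w. set w \<subseteq> (\<Union>i<m. A i) \<and> length w = m}"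
    by (fastforce simp: good_words_def in_set_conv_nth)
  show "finite {w. set w \<subseteq> (\<Union>i<m. A i) \<and> length w = m}"
    using assms by (intro finite_lists_length_eq) auto
qed

lemma good_words_take:
  "w \<in> good_words A m \<Longrightarrow> j \<le> m \<Longrightarrow> take j w \<in> good_words A j"
  by (auto simp: good_words_def intro: nonrep_sublist)

text \<open>The removed half has length \<open>Suc m - j\<close> and equals the last
  \<open>Suc m - j\<close> letters of \<open>u\<close>, which the \<open>drop\<close> reads off.
  Hence \<open>j\<close> and \<open>u\<close> determine the bad word, and each \<open>j\<close>
  accounts for at most as many bad words as there are good words of length \<open>j\<close>.\<close>

lemma bad_extension:
  assumes "w \<in> good_words A m" "a \<in> A m" "w @ [a] \<notin> good_words A (Suc m)"
  shows "\<exists>j\<le>m. \<exists>u\<in>good_words A j. w @ [a] = u @ drop (j - (Suc m - j)) u"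
proof -
  have "\<not> nonrep (w @ [a])"
    using assms by (auto simp: good_words_def nth_append less_Suc_eq)
  then obtain s where s: "sublist s (w @ [a])" "repetition s"
    unfolding nonrep_def by blast
  obtain x where x: "x \<noteq> []" "s = x @ x"
    using s(2) repetition_iff by blast
  obtain p q where pq: "w @ [a] = p @ s @ q"
    using s(1) unfolding sublist_def by blast
  \<comment> \<open>A square that stops before the new letter would lie in the non-repetitive word
    \<open>w\<close>.\<close>
  have "q = []"
  proof (rule ccontr)
    assume "q \<noteq> []"
    then have "w = p @ s @ butlast q"
      using pq by (metis butlast_append butlast_snoc append_is_Nil_conv)
    then have "sublist s w" by simp
    with assms(1) s(2) show False by (auto simp: good_words_def nonrep_def)
  qed
  define j where "j = length p + length x"
  have len: "length w = m" using assms(1) by (simp add: good_words_def)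
  have "length (w @ [a]) = length (p @ s @ q)" using pq by simp
  then have m: "Suc m = j + length x" using x \<open>q = []\<close> len by (simp add: j_def)
  then have "j \<le> m" using x(1) by (cases x) auto
  have "take j w = take j (w @ [a])" using \<open>j \<le> m\<close> len by simp
  also have "\<dots> = p @ x" using pq x j_def by simp
  finally have u: "p @ x \<in> good_words A j"
    using good_words_take[OF assms(1) \<open>j \<le> m\<close>] by simp
  have "j - (Suc m - j) = length p" using m by (simp add: j_def)
  then have "w @ [a] = (p @ x) @ drop (j - (Suc m - j)) (p @ x)"
    using pq x \<open>q = []\<close> by simp
  with u \<open>j \<le> m\<close> show ?thesis by blast
qed

lemma good_words_growth:
  assumes A: "\<And>i. finite (A i)" "\<And>i. card (A i) = 4"
  shows "4 * card (good_words A m)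
    \<le> card (good_words A (Suc m)) + (\<Sum>j\<le>m. card (good_words A j))"
proof -
  let ?g = "good_words A"
  define ext where "ext = (\<lambda>(w, a). w @ [a]) ` (?g m \<times> A m)"
  define B where "B = (\<Union>j\<le>m. (\<lambda>u. u @ drop (j - (Suc m - j)) u) ` ?g j)"
  have fin: "\<And>j. finite (?g j)" using finite_good_words A(1) by blast
  have "card ext = 4 * card (?g m)"
    unfolding ext_def by (subst card_image) (auto simp: inj_on_def card_cartesian_product A(2))
  moreover have "ext \<subseteq> ?g (Suc m) \<union> B"
    unfolding ext_def B_def using bad_extension[of _ A m] by fastforce
  then have "card ext \<le> card (?g (Suc m) \<union> B)"
    using fin by (intro card_mono) (auto simp: B_def)
  moreover have "card (?g (Suc m) \<union> B) \<le> card (?g (Suc m)) + card B"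
    by (rule card_Un_le)
  moreover have "card B \<le> (\<Sum>j\<le>m. card ((\<lambda>u. u @ drop (j - (Suc m - j)) u) ` ?g j))"
    unfolding B_def by (rule card_UN_le) simp
  moreover have "\<dots> \<le> (\<Sum>j\<le>m. card (?g j))"
    using fin by (intro sum_mono card_image_le)
  ultimately show ?thesis by linarith
qed

lemma good_words_nonempty:
  assumes A: "\<And>i. finite (A i)" "\<And>i. card (A i) = 4"
  shows "good_words A m \<noteq> {}"
proof -
  have "(\<Sum>j\<le>m. card (good_words A j)) \<le> 2 * card (good_words A m) \<and> 0 < card (good_words A m)"
  proof (induction m)
    case 0
    have "good_words A 0 = {[]}" by (auto simp: good_words_def)
    then show ?case by simp
  next
    case (Suc m)
    \<comment> \<open>Growth gives g (m + 1) \<ge> 2 * g m, so the new sum is at most 2 * g m + g (m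
      + 1) \<le> 2 * g (m + 1). For lists of size k and a bound c * g m, this step needs k \<le> c *
      (k - c), which is first solvable at k = 4, with c = 2.\<close>
    then show ?case using good_words_growth[of A m, OF A] by simp
  qed
  then show ?thesis by auto
qed

section \<open>From counting to list colourings of a path\<close>

definition at_least :: "nat \<Rightarrow> 'c set \<Rightarrow> bool" where
  "at_least k A \<longleftrightarrow> infinite A \<or> k \<le> card A"

lemma at_least_Diff:
  assumes "at_least k A" "finite F" "card F + l \<le> k"
  shows "at_least l (A - F)"
  using assms diff_card_le_card_Diff[of F A] by (auto simp: at_least_def Diff_infinite_finite)

lemma at_least_subset: "at_least k A \<Longrightarrow> \<exists>B\<subseteq>A. finite B \<and> card B = k"
  unfolding at_least_def by (metis infinite_arbitrarily_large obtain_subset_with_card_n)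

lemma at_least_nonempty: "at_least k A \<Longrightarrow> 0 < k \<Longrightarrow> \<exists>x. x \<in> A"
  unfolding at_least_def by (metis card.empty ex_in_conv finite.emptyI not_le)

lemma path_list_colouring:
  fixes L :: "'a \<Rightarrow> nat set"
  assumes "distinct xs" "\<And>v. v \<in> set xs \<Longrightarrow> at_least 4 (L v)"
  shows "\<exists>f. (\<forall>v\<in>set xs. f v \<in> L v) \<and> nonrep (map f xs)"
proof -
  define P where "P i B \<longleftrightarrow> (i < length xs \<longrightarrow> B \<subseteq> L (xs ! i)) \<and> finite B \<and> card B = 4" for i B
  have "\<exists>B. P i B" for i
  proof (cases "i < length xs")
    case True
    then show ?thesis using at_least_subset[OF assms(2), of "xs ! i"] by (auto simp: P_def)
  next
    case False
    \<comment> \<open>\<open>good_words\<close> takes a set at every index, so positions past the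
      end of the path get a dummy set of size four.\<close>
    then show ?thesis by (intro exI[of _ "{..<4}"]) (simp add: P_def)
  qed
  then obtain A where A: "\<And>i. P i (A i)" by metis
  then obtain w where w: "w \<in> good_words A (length xs)"
    using good_words_nonempty[of A "length xs"] unfolding P_def by blast
  define f where "f v = the (map_of (zip xs w) v)" for v
  have len: "length w = length xs" using w by (simp add: good_words_def)
  have f: "f (xs ! i) = w ! i" if "i < length xs" for i
    using map_of_zip_nth[OF len[symmetric] assms(1) that[folded len]] by (simp add: f_def)
  then have "map f xs = w"
    using len by (intro nth_equalityI) auto
  moreover have "\<forall>v\<in>set xs. f v \<in> L v"
    using A w f by (fastforce simp: in_set_conv_nth P_def good_words_def)
  ultimately show ?thesis using w by (auto simp: good_words_def)
qed

section \<open>Colouring a subdivided wheel\<close>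

text \<open>The rim with \<open>r 0\<close> left out: for \<open>k = n - 1\<close> it is the
  interior of the closed walk from \<open>r 0\<close> round to \<open>r 0\<close>, a path to which
  the counting argument applies in one go.\<close>

fun rim_path :: "(nat \<Rightarrow> 'a) \<Rightarrow> (nat \<Rightarrow> 'a list) \<Rightarrow> nat \<Rightarrow> 'a list" where
  "rim_path r R 0 = R 0"
| "rim_path r R (Suc k) = rim_path r R k @ r (Suc k) # R (Suc k)"

text \<open>The boundary walk of a face at \<open>c\<close>, with \<open>c\<close> left out, in the
  direction of \<open>face_succ\<close>: after leaving \<open>c\<close> along a spoke the walk turns
  towards the previous rim vertex, hence the reversed rim path.\<close>

definition inner_face ::
    "(nat \<Rightarrow> 'a) \<Rightarrow> (nat \<Rightarrow> 'a list) \<Rightarrow> (nat \<Rightarrow> 'a list) \<Rightarrow> nat \<Rightarrow> 'a list" where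
  "inner_face r S R i = S (Suc i) @ r (Suc i) # rev (R i) @ r i # rev (S i)"

definition wheel_vertices ::
    "nat \<Rightarrow> 'a \<Rightarrow> (nat \<Rightarrow> 'a) \<Rightarrow> (nat \<Rightarrow> 'a list) \<Rightarrow> (nat \<Rightarrow> 'a list) \<Rightarrow> 'a list" where
  "wheel_vertices n c r S R = c # concat (map (\<lambda>i. S i @ r i # R i) [0..<n])"

lemma set_rim_path: "set (rim_path r R k) = (\<Union>i\<le>k. set (R i)) \<union> r ` {1..k}"
  by (induction k) (auto simp: atMost_Suc atLeastAtMostSuc_conv)

lemma rim_path_segment:
  "0 < i \<Longrightarrow> i < k \<Longrightarrow> sublist (r i # R i @ [r (Suc i)]) (rim_path r R k)"
proof (induction k)
  case (Suc k)
  show ?case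
  proof (cases "i = k")
    case True
    then obtain j where "k = Suc j" using Suc.prems by (cases k) auto
    then have "rim_path r R (Suc k) = rim_path r R j @ (r i # R i @ [r (Suc i)]) @ R (Suc k)"
      using True by simp
    then show ?thesis by (metis sublist_appendI)
  next
    case False
    then have "sublist (r i # R i @ [r (Suc i)]) (rim_path r R k)" using Suc by simp
    then show ?thesis by (simp add: sublist_append)
  qed
qed simp

lemma rim_path_first: "0 < k \<Longrightarrow> sublist (R 0 @ [r 1]) (rim_path r R k)"
proof (induction k)
  case (Suc k)
  show ?case
  proof (cases k)
    case 0
    have "rim_path r R (Suc 0) = [] @ (R 0 @ [r 1]) @ R (Suc 0)" by simp
    then show ?thesis using 0 by (metis sublist_appendI)
  next
    case (Suc j)
    then have "sublist (R 0 @ [r 1]) (rim_path r R k)" using Suc.IH by simp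
    then show ?thesis by (simp add: sublist_append)
  qed
qed simp

lemma rim_path_last: "0 < k \<Longrightarrow> sublist (r k # R k) (rim_path r R k)"
  by (cases k) auto

lemma distinct_concat_upt:
  assumes "distinct (concat (map f [0..<n]))"
  shows "i < n \<Longrightarrow> distinct (f i)"
    and "i < n \<Longrightarrow> j < n \<Longrightarrow> i \<noteq> j \<Longrightarrow> set (f i) \<inter> set (f j) = {}"
proof -
  have "(\<forall>i<n. distinct (f i)) \<and> (\<forall>j<n. \<forall>i<j. set (f i) \<inter> set (f j) = {})"
    using assms
  proof (induction n)
    case (Suc n)
    then have "\<forall>i<n. set (f i) \<inter> set (f n) = {}" by (fastforce simp: disjoint_iff)
    with Suc show ?case by (simp add: All_less_Suc)
  qed simp
  then show "i < n \<Longrightarrow> distinct (f i)"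
    and "i < n \<Longrightarrow> j < n \<Longrightarrow> i \<noteq> j \<Longrightarrow> set (f i) \<inter> set (f j) = {}"
    by (blast, metis Int_commute nat_neq_iff)
qed

text \<open>Here \<open>a\<close> and \<open>b\<close> stand for the colours of consecutive rim
  vertices, \<open>y\<close> for the colour next to \<open>b\<close> on the second spoke,
  \<open>N\<close> for the rest of that spoke. If \<open>a = y\<close>, a square has to begin at
  \<open>a\<close>, and its second half at the other \<open>y\<close>. Its first half is then
  \<open>y # M @ [b]\<close>, whose copy would put \<open>b\<close> into \<open>N\<close>.\<close>

lemma nonrep_face_corner:
  assumes "nonrep (a # M @ [b])" "nonrep N"
    and "y \<notin> set M" "y \<noteq> b" "y \<notin> set N" "b \<notin> set N"
  shows "nonrep (a # M @ b # y # N)"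
proof (cases "a = y")
  case False
  then show ?thesis
    using nonrep_append_unique[of "a # M @ [b]" N y] assms by simp
next
  case True
  have tail: "nonrep (M @ b # y # N)"
    using nonrep_append_unique[of "M @ [b]" N y] assms
      nonrep_sublist[OF assms(1), of "M @ [b]"] by (simp add: sublist_Cons_right)
  show ?thesis
    unfolding nonrep_def
  proof (intro allI impI notI)
    fix s
    assume s: "sublist s (a # M @ b # y # N)" "repetition s"
    then obtain x where x: "x \<noteq> []" "s = x @ x" using repetition_iff by blast
    \<comment> \<open>A square starting later would lie in the tail, which is already
      non-repetitive.\<close>
    have "prefix s (a # M @ b # y # N)"
      using s tail unfolding nonrep_def by (auto simp: sublist_Cons_right)
    then obtain z where z: "a # M @ b # y # N = x @ x @ z"
      using x by (auto simp: prefix_def)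
    then obtain x' where x': "x = y # x'" using x(1) True by (cases x) auto
    have eq: "(M @ [b]) @ y # N = x' @ y # (x' @ z)" using z x' by simp
    have "y \<notin> set (M @ [b])" using assms by simp
    moreover have "y \<notin> set N" using assms by simp
    ultimately have "x' = M @ [b] \<and> x' @ z = N"
      using append_Cons_eq_iff[of y "M @ [b]" N x' "x' @ z"] eq by simp
    then show False using assms(6) by auto
  qed
qed

lemma avoiding_sequence:
  fixes X :: "nat \<Rightarrow> nat set"
  assumes "\<And>i. at_least 4 (X i)"
  shows "\<exists>\<eta>. \<eta> 0 = \<gamma> \<and> (\<forall>i. \<eta> (Suc i) \<in> X (Suc i) - {\<alpha>, \<gamma>, \<eta> i})"
proof -
  have ex: "\<exists>y. y \<in> X (Suc i) - {\<alpha>, \<gamma>, x}" for x i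
  proof -
    have "at_least 1 (X (Suc i) - {\<alpha>, \<gamma>, x})"
      by (rule at_least_Diff[OF assms]) (auto simp: card_insert_if)
    from at_least_nonempty[OF this zero_less_one] show ?thesis .
  qed
  have "\<exists>\<eta>. \<forall>i. (i = 0 \<longrightarrow> \<eta> i = \<gamma>) \<and> \<eta> (Suc i) \<in> X (Suc i) - {\<alpha>, \<gamma>, \<eta> i}"
    by (rule dependent_nat_choice) (use ex in auto)
  then show ?thesis by auto
qed

text \<open>Continuing \<open>r\<close> and \<open>S\<close> to index \<open>n\<close> allows
  \<open>Suc i\<close> in place of successors modulo \<open>n\<close>. Distinctness of the one list
  of all vertices encodes that the spokes and rim paths are pairwise disjoint.\<close>

locale wheel_lists =
  fixes n :: nat and c :: 'a and r :: "nat \<Rightarrow> 'a" and S R :: "nat \<Rightarrow> 'a list"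
  assumes n2: "2 \<le> n"
    and r_n: "r n = r 0" and S_n: "S n = S 0"
    and distinct_V: "distinct (wheel_vertices n c r S R)"
begin

text \<open>Lists belong to vertices, reserved colours to indices; \<open>owner\<close> leads from
  the former to the latter. Since the blocks are disjoint, the choice is unique on them.\<close>

definition owner :: "'a \<Rightarrow> nat" where
  "owner v = (SOME i. i < n \<and> v \<in> set (S i @ r i # R i))"

lemma block_distinct: "i < n \<Longrightarrow> distinct (S i @ r i # R i)"
  and block_disjoint: "i < n \<Longrightarrow> j < n \<Longrightarrow> i \<noteq> j \<Longrightarrow>
    set (S i @ r i # R i) \<inter> set (S j @ r j # R j) = {}"
  and centre_notin: "i < n \<Longrightarrow> c \<notin> set (S i @ r i # R i)"
  using distinct_V distinct_concat_upt[of "\<lambda>i. S i @ r i # R i" n]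
  unfolding wheel_vertices_def by auto

lemma owner_eq: "i < n \<Longrightarrow> v \<in> set (S i @ r i # R i) \<Longrightarrow> owner v = i"
  unfolding owner_def by (rule some_equality) (use block_disjoint in blast)+

lemma r_eq_iff: "i < n \<Longrightarrow> j < n \<Longrightarrow> r i = r j \<longleftrightarrow> i = j"
  using owner_eq[of _ "r i"] owner_eq[of _ "r j"] by (metis in_set_conv_decomp)

lemma r_notin: "i < n \<Longrightarrow> j < n \<Longrightarrow> r i \<notin> set (R j) \<and> r i \<notin> set (S j)"
proof (cases "i = j")
  case True
  then show "i < n \<Longrightarrow> ?thesis" using block_distinct[of i] by simp
next
  case False
  then show "i < n \<Longrightarrow> j < n \<Longrightarrow> ?thesis" using block_disjoint[of i j] by simp
qed

lemma RS_disjoint: "i < n \<Longrightarrow> j < n \<Longrightarrow> set (S i) \<inter> set (R j) = {}"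
proof (cases "i = j")
  case True
  then show "i < n \<Longrightarrow> ?thesis" using block_distinct[of i] by simp
next
  case False
  then show "i < n \<Longrightarrow> j < n \<Longrightarrow> ?thesis" using block_disjoint[of i j] by (simp add: Int_Un_distrib Int_Un_distrib2)
qed

lemma r0_notin_rim_path:
  assumes "k < n"
  shows "r 0 \<notin> set (rim_path r R k)"
proof -
  have "r 0 \<notin> set (R i)" if "i \<le> k" for i
    using r_notin[of 0 i] that assms by simp
  moreover have "r 0 \<noteq> r i" if "i \<in> {1..k}" for i
    using r_eq_iff[of 0 i] that assms by simp
  ultimately show ?thesis unfolding set_rim_path by blast
qed

lemma distinct_rim_path: "k < n \<Longrightarrow> distinct (rim_path r R k)"
proof (induction k)
  case 0
  then show ?case using block_distinct[of 0] by simp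
next
  case (Suc k)
  have "set (r i # R i) \<inter> set (r (Suc k) # R (Suc k)) = {}" if "i \<le> k" for i
    using block_disjoint[of i "Suc k"] that Suc.prems by (simp add: disjoint_iff)
  then have "set (rim_path r R k) \<inter> set (r (Suc k) # R (Suc k)) = {}"
    unfolding set_rim_path by (fastforce simp: disjoint_iff)
  then show ?case using Suc block_distinct[of "Suc k"] by simp
qed

text \<open>
  The last vertex of \<open>S i\<close>, for \<open>0 < i\<close>, is the neighbour of \<open>r i\<close> on its spoke; it gets the colour
  \<open>\<eta> i\<close>. On the spoke of \<open>r 0\<close> no vertex is singled out.
\<close>

definition spoke_rest :: "nat \<Rightarrow> 'a list" where
  "spoke_rest i = (if i = 0 then S 0 else butlast (S i))"

lemma spoke_rest_subset: "set (spoke_rest i) \<subseteq> set (S i)"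
  by (auto simp: spoke_rest_def dest: in_set_butlastD)

text \<open>These are the facts from which the faces are checked; each condition denies a vertex at
  most four colours. Those on \<open>S 0\<close> serve its two faces: \<gamma> splits both, and on
  the last face the cut at \<open>\<eta> (n - 1)\<close> comes before.\<close>

definition reserved_colouring ::
    "('a \<Rightarrow> nat) \<Rightarrow> nat \<Rightarrow> nat \<Rightarrow> (nat \<Rightarrow> nat) \<Rightarrow> bool" where
  "reserved_colouring \<phi> \<alpha> \<gamma> \<eta> \<longleftrightarrow>
     \<phi> c = \<alpha> \<and> \<phi> (r 0) = \<gamma> \<and> \<gamma> \<noteq> \<alpha> \<and>
     \<eta> 0 = \<gamma> \<and> (\<forall>i. \<eta> (Suc i) \<notin> {\<alpha>, \<gamma>, \<eta> i}) \<and>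
     (\<forall>i<n. \<phi> ` set (R i) \<inter> {\<alpha>, \<gamma>, \<eta> i, \<eta> (Suc i)} = {}) \<and>
     (\<forall>i<n. 0 < i \<longrightarrow> \<phi> (r i) \<notin> {\<alpha>, \<gamma>, \<eta> (i - 1), \<eta> i}) \<and>
     nonrep (map \<phi> (rim_path r R (n - 1))) \<and>
     (\<forall>i<n. nonrep (map \<phi> (spoke_rest i))) \<and>
     \<phi> ` set (S 0) \<inter> {\<alpha>, \<gamma>, \<eta> (n - 1)} = {} \<and>
     (\<forall>i<n. 0 < i \<longrightarrow> \<phi> ` set (butlast (S i)) \<inter> {\<alpha>, \<eta> (i - 1), \<eta> i, \<phi> (r i)} = {}) \<and>
     (\<forall>i<n. 0 < i \<longrightarrow> S i \<noteq> [] \<longrightarrow> \<phi> (last (S i)) = \<eta> i)"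

lemma reserved_colouringD:
  assumes "reserved_colouring \<phi> \<alpha> \<gamma> \<eta>"
  shows "\<phi> c = \<alpha>" "\<phi> (r 0) = \<gamma>" "\<gamma> \<noteq> \<alpha>" "\<eta> 0 = \<gamma>" "\<forall>i. \<eta> (Suc i) \<notin> {\<alpha>, \<gamma>, \<eta> i}"
    "\<forall>i<n. \<phi> ` set (R i) \<inter> {\<alpha>, \<gamma>, \<eta> i, \<eta> (Suc i)} = {}"
    "\<forall>i<n. 0 < i \<longrightarrow> \<phi> (r i) \<notin> {\<alpha>, \<gamma>, \<eta> (i - 1), \<eta> i}"
    "nonrep (map \<phi> (rim_path r R (n - 1)))"
    "\<forall>i<n. nonrep (map \<phi> (spoke_rest i))"
    "\<phi> ` set (S 0) \<inter> {\<alpha>, \<gamma>, \<eta> (n - 1)} = {}"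
    "\<forall>i<n. 0 < i \<longrightarrow> \<phi> ` set (butlast (S i)) \<inter> {\<alpha>, \<eta> (i - 1), \<eta> i, \<phi> (r i)} = {}"
    "\<forall>i<n. 0 < i \<longrightarrow> S i \<noteq> [] \<longrightarrow> \<phi> (last (S i)) = \<eta> i"
  using assms unfolding reserved_colouring_def by - (elim conjE, assumption)+

text \<open>The order of choice makes every forbidden set known in advance: reserved colours, then
  the rim, then the spokes, which have to avoid the colours of their rim vertices. Given the rim,
  the spokes are independent of each other.\<close>

lemma reserved_colouring_exists:
  assumes L: "\<And>v. v \<in> set (wheel_vertices n c r S R) \<Longrightarrow> at_least 8 (L v)"
  shows "\<exists>\<phi> \<alpha> \<gamma> \<eta>. reserved_colouring \<phi> \<alpha> \<gamma> \<eta> \<and>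
    (\<forall>v\<in>set (wheel_vertices n c r S R). \<phi> v \<in> L v)"
proof -
  have Lblock: "at_least 8 (L v)" if "i < n" "v \<in> set (S i @ r i # R i)" for i v
    by (rule L) (use that in \<open>auto simp: wheel_vertices_def\<close>)
  have Lc: "at_least 8 (L c)" using L by (simp add: wheel_vertices_def)
  then obtain \<alpha> where \<alpha>: "\<alpha> \<in> L c" using at_least_nonempty[of 8 "L c"] by auto
  have "at_least 1 (L (r 0) - {\<alpha>})"
    by (rule at_least_Diff[OF Lblock[of 0]]) (use n2 in auto)
  from at_least_nonempty[OF this zero_less_one]
  obtain \<gamma> where \<gamma>: "\<gamma> \<in> L (r 0)" "\<gamma> \<noteq> \<alpha>" by blast
  \<comment> \<open>On a spoke without interior vertices \<open>\<eta> i\<close> colours nothing, so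
    no list restricts it.\<close>
  define X where "X i = (if i < n \<and> S i \<noteq> [] then L (last (S i)) else UNIV)" for i
  have "at_least 4 (X i)" for i
    using Lblock[of i "last (S i)"] by (auto simp: X_def at_least_def)
  then obtain \<eta> where \<eta>: "\<eta> 0 = \<gamma>" "\<And>i. \<eta> (Suc i) \<in> X (Suc i)" "\<And>i. \<eta> (Suc i) \<notin> {\<alpha>, \<gamma>, \<eta> i}"
    using avoiding_sequence[of X \<gamma> \<alpha>] by blast
  define F where "F v = {\<alpha>, \<gamma>} \<union>
    (let i = owner v in if v = r i then {\<eta> (i - 1), \<eta> i} else {\<eta> i, \<eta> (Suc i)})" for v
  have rim_owner: "\<exists>i<n. v \<in> set (r i # R i)" if v: "v \<in> set (rim_path r R (n - 1))" for v
  proof -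
    consider i where "i \<le> n - 1" "v \<in> set (R i)" | i where "i \<le> n - 1" "v = r i"
      using v by (auto simp: set_rim_path)
    moreover have "i < n" if "i \<le> n - 1" for i using that n2 by linarith
    ultimately show ?thesis by (metis list.set_intros)
  qed
  have "at_least 4 (L v - F v)" if "v \<in> set (rim_path r R (n - 1))" for v
  proof (rule at_least_Diff)
    obtain i where "i < n" "v \<in> set (r i # R i)" using rim_owner \<open>v \<in> _\<close> by blast
    then show "at_least 8 (L v)" using Lblock[of i v] by auto
    show "finite (F v)" by (simp add: F_def Let_def)
    show "card (F v) + 4 \<le> 8" by (auto simp: F_def Let_def card_insert_if)
  qed
  then obtain \<rho> where \<rho>: "\<forall>v\<in>set (rim_path r R (n - 1)). \<rho> v \<in> L v - F v"
      "nonrep (map \<rho> (rim_path r R (n - 1)))"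
    using path_list_colouring[OF distinct_rim_path, of "n - 1" "\<lambda>v. L v - F v"] n2 by auto
  define \<psi> where "\<psi> v = (if v = r 0 then \<gamma> else \<rho> v)" for v
  define H where "H i = (if i = 0 then {\<alpha>, \<gamma>, \<eta> (n - 1)} else {\<alpha>, \<eta> (i - 1), \<eta> i, \<psi> (r i)})" for i
  have "\<exists>f. (\<forall>v\<in>set (spoke_rest i). f v \<in> L v - H i) \<and> nonrep (map f (spoke_rest i))"
    if "i < n" for i
  proof (rule path_list_colouring)
    show "distinct (spoke_rest i)"
      using block_distinct[of i] \<open>i < n\<close> by (auto simp: spoke_rest_def distinct_butlast)
    show "at_least 4 (L v - H i)" if "v \<in> set (spoke_rest i)" for v
    proof (rule at_least_Diff)
      show "at_least 8 (L v)" using Lblock[of i v] \<open>i < n\<close> that spoke_rest_subset by auto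
      show "finite (H i)" by (simp add: H_def)
      show "card (H i) + 4 \<le> 8"
        using card_length[of "[\<alpha>, \<gamma>, \<eta> (n - 1)]"] card_length[of "[\<alpha>, \<eta> (i - 1), \<eta> i, \<psi> (r i)]"]
        by (simp add: H_def)
    qed
  qed
  then obtain f where f: "\<And>i v. i < n \<Longrightarrow> v \<in> set (spoke_rest i) \<Longrightarrow> f i v \<in> L v - H i"
      "\<And>i. i < n \<Longrightarrow> nonrep (map (f i) (spoke_rest i))"
    by metis
  define \<phi> where "\<phi> v =
    (if v = c then \<alpha> else if v \<in> (\<Union>i<n. set (r i # R i)) then \<psi> v
     else let i = owner v in if 0 < i \<and> v = last (S i) then \<eta> i else f i v)" for v
  have \<phi>c: "\<phi> c = \<alpha>" by (simp add: \<phi>_def)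
  have \<phi>rim: "\<phi> v = \<psi> v" if "i < n" "v \<in> set (r i # R i)" for i v
    using that centre_notin[of i] by (auto simp: \<phi>_def)
  have \<phi>r0: "\<phi> (r 0) = \<gamma>" using \<phi>rim[of 0 "r 0"] n2 by (simp add: \<psi>_def)
  have \<phi>spoke: "\<phi> v = (if 0 < i \<and> v = last (S i) then \<eta> i else f i v)"
    if "i < n" "v \<in> set (S i)" for i v
  proof -
    have "v \<noteq> c" using centre_notin[of i] that by auto
    moreover have "v \<notin> (\<Union>i<n. set (r i # R i))"
      using that r_notin[of _ i] RS_disjoint[of i] by fastforce
    moreover have "owner v = i" using owner_eq that by simp
    ultimately show ?thesis by (simp add: \<phi>_def)
  qed
  have \<phi>last: "\<phi> (last (S i)) = \<eta> i" if "i < n" "0 < i" "S i \<noteq> []" for i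
    using \<phi>spoke[of i "last (S i)"] that by simp
  have \<phi>rest: "\<phi> v = f i v" if "i < n" "v \<in> set (spoke_rest i)" for i v
  proof -
    have "v \<in> set (S i)" using that spoke_rest_subset by blast
    moreover have "v \<noteq> last (S i)" if "0 < i"
    proof -
      have "distinct (butlast (S i) @ [last (S i)])"
        using block_distinct[OF \<open>i < n\<close>] \<open>v \<in> set (S i)\<close> by (cases "S i = []") auto
      then show ?thesis using \<open>v \<in> set (spoke_rest i)\<close> that by (auto simp: spoke_rest_def)
    qed
    ultimately show ?thesis using \<phi>spoke that by auto
  qed
  have \<phi>rim_path: "\<phi> v = \<rho> v" if "v \<in> set (rim_path r R (n - 1))" for v
    using rim_owner[OF that] \<phi>rim r0_notin_rim_path[of "n - 1"] that n2 by (auto simp: \<psi>_def)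
  have \<phi>F: "\<phi> v \<in> L v \<and> \<phi> v \<notin> F v" if "v \<in> set (rim_path r R (n - 1))" for v
    using \<rho>(1) \<phi>rim_path that by simp
  have \<phi>H: "\<phi> v \<in> L v \<and> \<phi> v \<notin> H i" if "i < n" "v \<in> set (spoke_rest i)" for i v
    using f(1)[OF that] \<phi>rest[OF that] by simp
  have in_rim: "v \<in> set (rim_path r R (n - 1))" if "i < n" "v \<in> set (R i) \<or> 0 < i \<and> v = r i" for i v
  proof -
    have "i \<le> n - 1" using that by linarith
    then show ?thesis using that(2) by (auto simp: set_rim_path)
  qed
  have "reserved_colouring \<phi> \<alpha> \<gamma> \<eta>"
    unfolding reserved_colouring_def
  proof (intro conjI allI impI)
    fix i assume i: "i < n"
    show "\<phi> ` set (R i) \<inter> {\<alpha>, \<gamma>, \<eta> i, \<eta> (Suc i)} = {}"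
    proof -
      have "\<phi> v \<notin> {\<alpha>, \<gamma>, \<eta> i, \<eta> (Suc i)}" if "v \<in> set (R i)" for v
      proof -
        have "v \<in> set (rim_path r R (n - 1))" using in_rim i that by blast
        moreover have "owner v = i" using owner_eq i that by simp
        moreover have "v \<noteq> r i" using r_notin[of i i] i that by auto
        ultimately show ?thesis using \<phi>F[of v] by (simp add: F_def)
      qed
      then show ?thesis by blast
    qed
    assume "0 < i"
    then have "r i \<in> set (rim_path r R (n - 1))" using in_rim i by blast
    moreover have "owner (r i) = i" using owner_eq i by simp
    ultimately show "\<phi> (r i) \<notin> {\<alpha>, \<gamma>, \<eta> (i - 1), \<eta> i}"
      using \<phi>F[of "r i"] by (simp add: F_def)
  next
    have "map \<phi> (rim_path r R (n - 1)) = map \<rho> (rim_path r R (n - 1))"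
      using \<phi>rim_path by (intro map_cong) auto
    then show "nonrep (map \<phi> (rim_path r R (n - 1)))" using \<rho>(2) by argo
  next
    fix i assume i: "i < n"
    have "map \<phi> (spoke_rest i) = map (f i) (spoke_rest i)"
      using \<phi>rest i by (intro map_cong) auto
    then show "nonrep (map \<phi> (spoke_rest i))" using f(2)[OF i] by argo
  next
    have "\<phi> v \<notin> {\<alpha>, \<gamma>, \<eta> (n - 1)}" if "v \<in> set (S 0)" for v
      using \<phi>H[of 0 v] n2 that by (simp add: spoke_rest_def H_def)
    then show "\<phi> ` set (S 0) \<inter> {\<alpha>, \<gamma>, \<eta> (n - 1)} = {}" by blast
  next
    fix i assume i: "i < n" "0 < i"
    have "\<psi> (r i) = \<phi> (r i)" using \<phi>rim i by simp
    then have "\<phi> v \<notin> {\<alpha>, \<eta> (i - 1), \<eta> i, \<phi> (r i)}" if "v \<in> set (butlast (S i))" for v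
      using \<phi>H[of i v] i that by (simp add: spoke_rest_def H_def)
    then show "\<phi> ` set (butlast (S i)) \<inter> {\<alpha>, \<eta> (i - 1), \<eta> i, \<phi> (r i)} = {}" by blast
  qed (use \<phi>c \<phi>r0 \<gamma> \<eta> \<phi>last in auto)
  moreover have "\<phi> v \<in> L v" if v: "v \<in> set (wheel_vertices n c r S R)" for v
  proof -
    consider "v = c" | "v = r 0" | i where "i < n" "v \<in> set (R i) \<or> 0 < i \<and> v = r i"
      | i where "i < n" "0 < i" "S i \<noteq> []" "v = last (S i)"
      | i where "i < n" "v \<in> set (spoke_rest i)"
    proof -
      consider "v = c" | i where "i < n" "v \<in> set (R i)" | i where "i < n" "v = r i"
        | i where "i < n" "v \<in> set (S i)"
        using v by (auto simp: wheel_vertices_def)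
      then show ?thesis
      proof cases
        case (4 i)
        show ?thesis
        proof (cases "v \<in> set (spoke_rest i)")
          case False
          then have "0 < i" using 4 by (cases "i = 0") (auto simp: spoke_rest_def)
          have ne: "S i \<noteq> []" using 4 by auto
          have "v \<in> set (butlast (S i) @ [last (S i)])"
            unfolding append_butlast_last_id[OF ne] using 4 by blast
          then have "v = last (S i)" using False \<open>0 < i\<close> unfolding spoke_rest_def by auto
          with \<open>0 < i\<close> ne 4 that show ?thesis by blast
        qed (use 4 that in blast)
      qed (use that in \<open>metis neq0_conv\<close>)+
    qed
    then show ?thesis
    proof cases
      case (3 i)
      then have "v \<in> set (rim_path r R (n - 1))" using in_rim by blast
      then show ?thesis using \<phi>F by blast
    next
      case (4 i)
      then obtain j where "i = Suc j" using gr0_implies_Suc by blast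
      then have "\<eta> i \<in> X i" using \<eta>(2) by simp
      then show ?thesis using 4 \<phi>last by (simp add: X_def)
    next
      case (5 i)
      then show ?thesis using \<phi>H by blast
    qed (use \<alpha> \<gamma> \<phi>c \<phi>r0 in auto)
  qed
  ultimately show ?thesis by blast
qed

text \<open>\<open>M\<close> is the remainder of face \<open>i\<close>. The spoke meets it at the
  colour \<open>\<eta> i\<close>, which occurs nowhere else in the word; if the spoke has no
  interior vertices, there is nothing to cut off.\<close>

lemma nonrep_spoke:
  assumes "reserved_colouring \<phi> \<alpha> \<gamma> \<eta>" "0 < i" "i < n"
    and "nonrep M" "\<eta> i \<notin> set M"
  shows "nonrep (map \<phi> (S i) @ M)"
proof (cases "S i = []")
  case False
  have "nonrep (map \<phi> (butlast (S i)) @ \<eta> i # M)"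
  proof (rule nonrep_append_unique)
    show "nonrep (map \<phi> (butlast (S i)))"
      using reserved_colouringD(9)[OF assms(1), rule_format, of i] assms(2,3) by (simp add: spoke_rest_def)
    show "\<eta> i \<notin> set (map \<phi> (butlast (S i)))"
      using reserved_colouringD(11)[OF assms(1)] assms(2,3) by fastforce
  qed (use assms in auto)
  moreover have "\<phi> (last (S i)) = \<eta> i"
    using reserved_colouringD(12)[OF assms(1)] assms(2,3) False by blast
  then have "map \<phi> (butlast (S i) @ [last (S i)]) = map \<phi> (butlast (S i)) @ [\<eta> i]"
    by simp
  then have "map \<phi> (S i) = map \<phi> (butlast (S i)) @ [\<eta> i]"
    unfolding append_butlast_last_id[OF False] .
  ultimately show ?thesis by simp
qed (use assms in simp)

lemma set_spoke_colours:
  assumes "reserved_colouring \<phi> \<alpha> \<gamma> \<eta>" "0 < i" "i < n"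
  shows "\<phi> ` set (S i) \<subseteq> insert (\<eta> i) (\<phi> ` set (butlast (S i)))"
proof (cases "S i = []")
  case False
  have "set (butlast (S i) @ [last (S i)]) = insert (last (S i)) (set (butlast (S i)))"
    by simp
  then have "set (S i) = insert (last (S i)) (set (butlast (S i)))"
    unfolding append_butlast_last_id[OF False] .
  moreover have "\<phi> (last (S i)) = \<eta> i"
    using reserved_colouringD(12)[OF assms(1)] assms(2,3) False by blast
  ultimately show ?thesis by auto
qed simp

lemma nonrep_inner_face:
  assumes col: "reserved_colouring \<phi> \<alpha> \<gamma> \<eta>" and i: "i < n"
  shows "nonrep (map \<phi> (inner_face r S R i))"
    and "\<alpha> \<notin> \<phi> ` set (inner_face r S R i)"
proof -
  note C = reserved_colouringD[OF col]
  have R: "\<phi> ` set (R j) \<inter> {\<alpha>, \<gamma>, \<eta> j, \<eta> (Suc j)} = {}" if "j < n" for j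
    using C(6) that by blast
  have r: "\<phi> (r j) \<notin> {\<alpha>, \<gamma>, \<eta> (j - 1), \<eta> j}" if "j < n" "0 < j" for j
    using C(7) that by blast
  have rim: "nonrep (map \<phi> M)" if "sublist M (rim_path r R (n - 1))" for M
    using nonrep_sublist[OF C(8) map_mono_sublist[OF that]] .
  have S0: "nonrep (map \<phi> (S 0))" "\<phi> ` set (S 0) \<inter> {\<alpha>, \<gamma>, \<eta> (n - 1)} = {}"
    using C(9)[rule_format, of 0] C(10) n2 by (auto simp: spoke_rest_def)
  have B: "\<phi> ` set (butlast (S j)) \<inter> {\<alpha>, \<eta> (j - 1), \<eta> j, \<phi> (r j)} = {}"
    "nonrep (map \<phi> (butlast (S j)))" if "j < n" "0 < j" for j
    using C(9)[rule_format, of j] C(11) that by (auto simp: spoke_rest_def)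
  have \<eta>: "\<eta> j \<notin> {\<alpha>, \<gamma>, \<eta> (j - 1)}" if "0 < j" for j
    using C(5)[rule_format, of "j - 1"] that by simp
  have c0: "\<phi> (r 0) = \<gamma>" "\<gamma> \<noteq> \<alpha>" "\<eta> 0 = \<gamma>" using C(2-4) by auto
  have S: "\<phi> ` set (S j) \<inter> {\<alpha>, \<eta> (j - 1)} = {}" if "j < n" "0 < j" for j
    using set_spoke_colours[OF col that(2,1)] B(1)[OF that] \<eta>[OF that(2)] by auto
  have Sa: "\<alpha> \<notin> \<phi> ` set (S j)" if "j < n" for j
    using S[OF that] S0 by (cases "j = 0") auto
  have ra: "\<alpha> \<noteq> \<phi> (r j)" if "j < n" for j using r[OF that] c0 by (cases "j = 0") auto
  have "\<alpha> \<notin> \<phi> ` set (S (Suc i)) \<and> \<alpha> \<noteq> \<phi> (r (Suc i))"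
    using Sa ra r_n S_n n2 i by (cases "Suc i = n") auto
  moreover have "\<alpha> \<notin> \<phi> ` set (R i)" using R[OF i] by auto
  ultimately show "\<alpha> \<notin> \<phi> ` set (inner_face r S R i)"
    using Sa[OF i] ra[OF i] by (auto simp: inner_face_def)
  \<comment> \<open>The face is read backwards so that spoke \<open>i\<close> comes first, as in
    \<open>nonrep_spoke\<close>.\<close>
  define W where "W = map \<phi> (S i) @ \<phi> (r i) # map \<phi> (R i) @ \<phi> (r (Suc i)) # rev (map \<phi> (S (Suc i)))"
  have "nonrep W"
  proof (cases "i = 0")
    case True
    \<comment> \<open>Face 0 is cut at \<gamma>, which spoke 1 avoids because
      \<open>\<eta> 0 = \<gamma>\<close>. The part behind it is cut at \<open>\<eta> 1\<close>, read
      from the other end.\<close>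
    have "nonrep (map \<phi> (S 0) @ \<gamma> # (map \<phi> (R 0) @ \<phi> (r 1) # rev (map \<phi> (S 1))))"
    proof (rule nonrep_append_unique)
      have "nonrep (map \<phi> (S 1) @ rev (map \<phi> (R 0 @ [r 1])))"
      proof (rule nonrep_spoke[OF col])
        show "nonrep (rev (map \<phi> (R 0 @ [r 1])))"
          unfolding nonrep_rev by (intro rim rim_path_first) (use n2 in simp)
        show "\<eta> 1 \<notin> set (rev (map \<phi> (R 0 @ [r 1])))"
          using R[of 0] r[of 1] n2 by auto
      qed (use n2 in auto)
      then have "nonrep (rev (map \<phi> (S 1) @ rev (map \<phi> (R 0 @ [r 1]))))" unfolding nonrep_rev .
      then show "nonrep (map \<phi> (R 0) @ \<phi> (r 1) # rev (map \<phi> (S 1)))" by simp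
      show "\<gamma> \<notin> set (map \<phi> (R 0) @ \<phi> (r 1) # rev (map \<phi> (S 1)))"
        using R[of 0] r[of 1] S[of 1] c0 n2 by auto
    qed (use S0 in auto)
    then show ?thesis using c0 True by (simp add: W_def)
  next
    case False
    then have "0 < i" by simp
    show ?thesis
    proof (cases "Suc i = n")
      case True
      then have n1: "n - 1 = i" by simp
      \<comment> \<open>On the last face the part beyond spoke \<open>n - 1\<close> is cut at the
        colour \<gamma> of \<open>r n = r 0\<close>.\<close>
      have "nonrep ((\<phi> (r i) # map \<phi> (R i)) @ \<gamma> # rev (map \<phi> (S 0)))"
      proof (rule nonrep_append_unique)
        show "nonrep (\<phi> (r i) # map \<phi> (R i))"
          using rim[of "r i # R i"] rim_path_last[OF \<open>0 < i\<close>, of r R] n1 by simp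
        show "\<gamma> \<notin> set (\<phi> (r i) # map \<phi> (R i))"
          using r[of i] R[of i] i \<open>0 < i\<close> by auto
      qed (use S0 in auto)
      moreover have "\<eta> i \<notin> set ((\<phi> (r i) # map \<phi> (R i)) @ \<gamma> # rev (map \<phi> (S 0)))"
        using r[of i] R[of i] i \<open>0 < i\<close> S0 n1 \<eta>[of i] by auto
      ultimately show ?thesis
        using nonrep_spoke[OF col \<open>0 < i\<close> i] c0 r_n S_n True by (simp add: W_def)
    next
      case False
      then have i': "Suc i < n" using i by simp
      \<comment> \<open>The remaining faces do not contain \<open>r 0\<close>, so their rim part
        lies within the opened rim.\<close>
      have M: "nonrep (\<phi> (r i) # map \<phi> (R i) @ [\<phi> (r (Suc i))])"
        using rim[of "r i # R i @ [r (Suc i)]"] rim_path_segment[OF \<open>0 < i\<close>, of "n - 1" r R] i' by simp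
      have "nonrep (\<phi> (r i) # map \<phi> (R i) @ \<phi> (r (Suc i)) # rev (map \<phi> (S (Suc i))))"
      proof (cases "S (Suc i) = []")
        case False
        have "nonrep (\<phi> (r i) # map \<phi> (R i) @ \<phi> (r (Suc i)) # \<eta> (Suc i) # rev (map \<phi> (butlast (S (Suc i)))))"
        proof (rule nonrep_face_corner[OF M])
          show "nonrep (rev (map \<phi> (butlast (S (Suc i)))))"
            unfolding nonrep_rev using B(2)[OF i'] by simp
        qed (use R[OF i] r[OF i'] B(1)[OF i'] in auto)
        moreover have "\<phi> (last (S (Suc i))) = \<eta> (Suc i)" using C(12) i' False by blast
        then have "rev (map \<phi> (butlast (S (Suc i)) @ [last (S (Suc i))]))
            = \<eta> (Suc i) # rev (map \<phi> (butlast (S (Suc i))))"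
          by simp
        then have "rev (map \<phi> (S (Suc i))) = \<eta> (Suc i) # rev (map \<phi> (butlast (S (Suc i))))"
          unfolding append_butlast_last_id[OF False] .
        ultimately show ?thesis by simp
      qed (use M in simp)
      moreover have "\<eta> i \<notin> set (\<phi> (r i) # map \<phi> (R i) @ \<phi> (r (Suc i)) # rev (map \<phi> (S (Suc i))))"
        using r[OF i \<open>0 < i\<close>] R[OF i] r[OF i'] S[OF i'] by auto
      ultimately show ?thesis
        using nonrep_spoke[OF col \<open>0 < i\<close> i] by (simp add: W_def)
    qed
  qed
  moreover have "map \<phi> (inner_face r S R i) = rev W"
    by (simp add: W_def inner_face_def rev_map)
  ultimately show "nonrep (map \<phi> (inner_face r S R i))" by simp
qed

text \<open>Each closed walk is opened at a vertex whose colour recurs nowhere on it, the rim at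
  \<open>r 0\<close> and the inner faces at \<open>c\<close>. This is the form in which
  \<open>facial_nonrepetitiveI\<close> takes its faces.\<close>

lemma wheel_list_colouring:
  assumes "\<And>v. v \<in> set (wheel_vertices n c r S R) \<Longrightarrow> at_least 8 (L v)"
  shows "\<exists>\<phi> :: 'a \<Rightarrow> nat. (\<forall>v\<in>set (wheel_vertices n c r S R). \<phi> v \<in> L v) \<and>
    \<phi> (r 0) \<notin> \<phi> ` set (rim_path r R (n - 1)) \<and> nonrep (map \<phi> (rim_path r R (n - 1))) \<and>
    (\<forall>i<n. \<phi> c \<notin> \<phi> ` set (inner_face r S R i) \<and> nonrep (map \<phi> (inner_face r S R i)))"
proof -
  obtain \<phi> \<alpha> \<gamma> \<eta> where col: "reserved_colouring \<phi> \<alpha> \<gamma> \<eta>"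
    and L: "\<forall>v\<in>set (wheel_vertices n c r S R). \<phi> v \<in> L v"
    using reserved_colouring_exists assms by blast
  note C = reserved_colouringD[OF col]
  have "\<phi> v \<noteq> \<gamma>" if v: "v \<in> set (rim_path r R (n - 1))" for v
  proof -
    consider i where "i \<le> n - 1" "v \<in> set (R i)" | i where "i \<le> n - 1" "0 < i" "v = r i"
      using v by (auto simp: set_rim_path)
    then show ?thesis
    proof cases
      case (1 i)
      then have "\<phi> ` set (R i) \<inter> {\<alpha>, \<gamma>, \<eta> i, \<eta> (Suc i)} = {}" using C(6) n2 by simp
      then show ?thesis using 1 by blast
    next
      case (2 i)
      then show ?thesis using C(7)[rule_format, of i] n2 by simp
    qed
  qed
  then have "\<phi> (r 0) \<notin> \<phi> ` set (rim_path r R (n - 1))"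
    unfolding C(2) by blast
  moreover have "\<forall>i<n. \<phi> c \<notin> \<phi> ` set (inner_face r S R i) \<and> nonrep (map \<phi> (inner_face r S R i))"
    unfolding C(1) using nonrep_inner_face[OF col] by blast
  ultimately show ?thesis using C(8) L by blast
qed

end

section \<open>The faces of a subdivided wheel\<close>

fun walk_darts :: "'a \<Rightarrow> 'a list \<Rightarrow> 'a \<Rightarrow> ('a \<times> 'a) list" where
  "walk_darts a [] b = [(a, b)]"
| "walk_darts a (x # xs) b = (a, x) # walk_darts x xs b"

lemma walk_darts_append: "walk_darts a (xs @ x # ys) b = walk_darts a xs x @ walk_darts x ys b"
  by (induction xs arbitrary: a) auto

lemma walk_darts_rev: "walk_darts b (rev xs) a = rev (map prod.swap (walk_darts a xs b))"
  by (induction xs arbitrary: a) (auto simp: walk_darts_append)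

lemma map_fst_walk_darts: "map fst (walk_darts a xs b) = a # xs"
  by (induction xs arbitrary: a) auto

section \<open>Facial paths as windows of closed walks\<close>

definition face_walk :: "('a \<times> 'a \<Rightarrow> 'a \<times> 'a) \<Rightarrow> ('a \<times> 'a) list \<Rightarrow> bool" where
  "face_walk rot ds \<longleftrightarrow>
    ds \<noteq> [] \<and> successively (\<lambda>d d'. face_succ rot d = d') (ds @ [hd ds])"

lemma face_walk_nth:
  assumes "face_walk rot ds" "j < length ds"
  shows "face_succ rot (ds ! j) = ds ! (Suc j mod length ds)"
proof -
  have "face_succ rot (xs ! j) = xs ! Suc j"
    if "successively (\<lambda>d d'. face_succ rot d = d') xs" "Suc j < length xs" for xs j
    using that
  proof (induction xs arbitrary: j)
    case (Cons x xs)
    then show ?case by (cases j) (auto simp: successively_Cons hd_conv_nth)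
  qed simp
  from this[of "ds @ [hd ds]" j] have "face_succ rot (ds ! j) = (ds @ [hd ds]) ! Suc j"
    using assms by (simp add: face_walk_def nth_append)
  then show ?thesis
    using assms by (cases "Suc j = length ds") (auto simp: nth_append hd_conv_nth face_walk_def)
qed

lemma face_walk_funpow:
  assumes "face_walk rot ds" "j < length ds"
  shows "(face_succ rot ^^ i) (ds ! j) = ds ! ((j + i) mod length ds)"
proof (induction i)
  case (Suc i)
  have "(j + i) mod length ds < length ds" using assms(2) by (intro mod_less_divisor) auto
  then show ?case using Suc face_walk_nth[OF assms(1)] by (simp add: mod_Suc_eq)
qed (use assms in simp)

text \<open>A segment longer than the closed walk would repeat its first vertex. A window of at most
  one full turn may wrap around the end of the list, but it fits into two copies.\<close>

lemma boundary_segment_sublist: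
  assumes ds: "face_walk rot ds" "d \<in> set ds"
    and p: "p = boundary_segment rot d k" "distinct p"
  shows "sublist p (map fst ds @ map fst ds)"
proof -
  let ?l = "length ds"
  obtain j where j: "j < ?l" "d = ds ! j" using ds(2) by (auto simp: in_set_conv_nth)
  have nth: "p ! i = fst (ds ! ((j + i) mod ?l))" if "i < k" for i
    using that p(1) face_walk_funpow[OF ds(1) j(1)] j(2) by (simp add: boundary_segment_def)
  have len: "length p = k" using p(1) by (simp add: boundary_segment_def)
  have "k \<le> ?l"
  proof (rule ccontr)
    assume "\<not> k \<le> ?l"
    then have "p ! 0 = p ! ?l" using nth[of 0] nth[of ?l] by simp
    moreover have "0 < ?l" using j(1) by linarith
    ultimately show False
      using \<open>\<not> k \<le> ?l\<close> p(2) len by (simp add: nth_eq_iff_index_eq)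
  qed
  have "p = take k (drop j (map fst ds @ map fst ds))"
  proof (rule nth_equalityI)
    show "length p = length (take k (drop j (map fst ds @ map fst ds)))"
      using len j(1) \<open>k \<le> ?l\<close> by simp
    fix i assume "i < length p"
    then have "i < k" using len by simp
    have "(map fst ds @ map fst ds) ! (j + i) = fst (ds ! ((j + i) mod ?l))"
    proof (cases "j + i < ?l")
      case False
      then have "(j + i) mod ?l = j + i - ?l"
        using j(1) \<open>i < k\<close> \<open>k \<le> ?l\<close> by (simp add: le_mod_geq)
      then show ?thesis using False j(1) \<open>i < k\<close> \<open>k \<le> ?l\<close> by (simp add: nth_append)
    qed (simp add: nth_append)
    then show "p ! i = take k (drop j (map fst ds @ map fst ds)) ! i"
      using nth[OF \<open>i < k\<close>] \<open>i < k\<close> j(1) by (simp del: drop_append take_append)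
  qed
  then show ?thesis by (metis sublist_order.order.trans sublist_drop sublist_take)
qed

text \<open>If \<open>p\<close> meets \<open>a\<close>, the colour of \<open>a\<close> occurs
  exactly once in the word, which is therefore no square. Otherwise \<open>p\<close> lies in one of
  the two copies of \<open>K\<close>.\<close>

lemma cyclic_sublist_not_repetition:
  assumes p: "sublist p ((a # K) @ (a # K))" "distinct p"
    and K: "\<phi> a \<notin> \<phi> ` set K" "nonrep (map \<phi> K)"
  shows "\<not> repetition (map \<phi> p)"
proof (cases "a \<in> set p")
  case False
  have "sublist p K"
    using sublist_append_Cons_cases[of p "[]" a "K @ a # K"] sublist_append_Cons_cases[of p K a K]
      p(1) False by auto
  then show ?thesis using K(2) map_mono_sublist unfolding nonrep_def by blast
next
  case True
  then obtain q q' where q: "p = q @ a # q'" by (auto simp: in_set_conv_decomp)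
  have "set p \<subseteq> insert a (set K)" using set_mono_sublist[OF p(1)] by auto
  then have "\<phi> a \<notin> set (map \<phi> q)" "\<phi> a \<notin> set (map \<phi> q')"
    using K(1) p(2) q by auto
  then have "count_list (map \<phi> q) (\<phi> a) = 0" "count_list (map \<phi> q') (\<phi> a) = 0"
    unfolding count_list_0_iff .
  then have "count_list (map \<phi> p) (\<phi> a) = 1"
    unfolding q by simp
  moreover have "\<phi> a \<in> set (map \<phi> p)" using True by simp
  ultimately show ?thesis using repetition_count_list[of "map \<phi> p" "\<phi> a"] by linarith
qed

lemma facial_nonrepetitiveI:
  assumes "\<And>d. d \<in> parcs G \<Longrightarrow> \<exists>a K. d \<in> set (walk_darts a K a) \<and> face_walk rot (walk_darts a K a)
    \<and> \<phi> a \<notin> \<phi> ` set K \<and> nonrep (map \<phi> K)"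
  shows "facial_nonrepetitive G rot \<phi>"
proof -
  have *: "\<not> repetition (map \<phi> p)"
    if p: "p = boundary_segment rot d (length p)" "distinct p" and d: "d \<in> parcs G" for p d
  proof -
    obtain a K where K: "d \<in> set (walk_darts a K a)" "face_walk rot (walk_darts a K a)"
      "\<phi> a \<notin> \<phi> ` set K" "nonrep (map \<phi> K)"
      using assms[OF d] by blast
    have "sublist p ((a # K) @ (a # K))"
      using boundary_segment_sublist[OF K(2,1) p] unfolding map_fst_walk_darts .
    then show ?thesis using cyclic_sublist_not_repetition p(2) K(3,4) by metis
  qed
  show ?thesis
    unfolding facial_nonrepetitive_def facial_path_def
  proof (intro allI impI, elim conjE bexE disjE)
    fix p d
    \<comment> \<open>A path listed against the walk is reversed; this preserves squares.\<close>
    assume "distinct p" "d \<in> parcs G" "rev p = boundary_segment rot d (length p)"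
    then have "\<not> repetition (map \<phi> (rev p))" using *[of "rev p" d] unfolding length_rev distinct_rev by blast
    then show "\<not> repetition (map \<phi> p)" by (simp add: rev_map[symmetric])
  qed (use * in blast)
qed

subsection \<open>Subdividing an edge\<close>

text \<open>The undirected edge of a dart; it serves to state that every edge is listed
  once.\<close>

definition ends :: "'a \<times> 'a \<Rightarrow> 'a set" where
  "ends d = {fst d, snd d}"

text \<open>\<open>subdivide_path u v w a xs b\<close> are the interior vertices of the path \<open>a, xs, b\<close> after \<open>w\<close> has been
  placed on the edge \<open>uv\<close>.\<close>

fun subdivide_path :: "'a \<Rightarrow> 'a \<Rightarrow> 'a \<Rightarrow> 'a \<Rightarrow> 'a list \<Rightarrow> 'a \<Rightarrow> 'a list" where
  "subdivide_path u v w a [] b = (if {a, b} = {u, v} then [w] else [])"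
| "subdivide_path u v w a (x # xs) b =
    (if {a, x} = {u, v} then [w] else []) @ x # subdivide_path u v w x xs b"

definition subdivide_dart :: "'a \<Rightarrow> 'a \<Rightarrow> 'a \<Rightarrow> 'a \<times> 'a \<Rightarrow> ('a \<times> 'a) list" where
  "subdivide_dart u v w d = (if ends d = {u, v} then [(fst d, w), (w, snd d)] else [d])"

lemma subdivide_dart_simps [simp]:
  "{a, b} = {u, v} \<Longrightarrow> subdivide_dart u v w (a, b) = [(a, w), (w, b)]"
  "{a, b} \<noteq> {u, v} \<Longrightarrow> subdivide_dart u v w (a, b) = [(a, b)]"
  by (simp_all add: subdivide_dart_def ends_def)

lemma subdivide_dart_neq_Nil [simp]: "subdivide_dart u v w d \<noteq> []"
  by (simp add: subdivide_dart_def)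

lemma subdivide_dart_swap:
  "subdivide_dart u v w (prod.swap d) = rev (map prod.swap (subdivide_dart u v w d))"
  by (simp add: subdivide_dart_def ends_def insert_commute)

lemma subdivide_path_append:
  "subdivide_path u v w a (xs @ x # ys) b = subdivide_path u v w a xs x @ x # subdivide_path u v w x ys b"
  by (induction xs arbitrary: a) auto

lemma subdivide_path_rev:
  "rev (subdivide_path u v w a xs b) = subdivide_path u v w b (rev xs) a"
  by (induction xs arbitrary: a) (auto simp: subdivide_path_append insert_commute)

lemma walk_darts_subdivide:
  "walk_darts a (subdivide_path u v w a xs b) b =
    concat (map (subdivide_dart u v w) (walk_darts a xs b))"
  by (induction xs arbitrary: a) auto

text \<open>Multisets count how often \<open>w\<close> enters without saying where. Once
  \<open>uv\<close> is known to be traversed exactly once in all, distinctness of the new vertex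
  list follows.\<close>

lemma mset_subdivide_path:
  "mset (subdivide_path u v w a xs b) =
    mset xs + replicate_mset (length (filter (\<lambda>d. ends d = {u, v}) (walk_darts a xs b))) w"
  by (induction xs arbitrary: a) (auto simp: ends_def)

text \<open>The halves of a divided edge contain \<open>w\<close> and no old edge does; the list
  being distinct, \<open>uv\<close> is divided at most once.\<close>

lemma distinct_ends_subdivide:
  assumes "distinct (map ends ds)" "\<And>a b. (a, b) \<in> set ds \<Longrightarrow> a \<noteq> b \<and> a \<noteq> w \<and> b \<noteq> w"
  shows "distinct (map ends (concat (map (subdivide_dart u v w) ds)))"
  using assms
proof (induction ds)
  case (Cons d ds)
  obtain a b where d: "d = (a, b)" by force
  have ab: "a \<noteq> b" "a \<noteq> w" "b \<noteq> w" using Cons.prems(2)[of a b] d by auto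
  have no_w: "w \<notin> ends e" if "e \<in> set ds" for e
    using Cons.prems(2)[of "fst e" "snd e"] that by (auto simp: ends_def)
  have IH: "distinct (map ends (concat (map (subdivide_dart u v w) ds)))"
    using Cons by auto
  show ?case
  proof (cases "ends d = {u, v}")
    case True
    then have "ends e \<noteq> {u, v}" if "e \<in> set ds" for e
      using Cons.prems(1) that by (auto simp: image_iff)
    then have "map (subdivide_dart u v w) ds = map (\<lambda>e. [e]) ds"
      by (simp add: subdivide_dart_def)
    then have tail: "concat (map (subdivide_dart u v w) ds) = ds"
      using concat_map_singleton[of "\<lambda>e. e" ds] by (simp only: map_ident)
    have "ends (a, w) \<noteq> ends e" "ends (w, b) \<noteq> ends e" if "e \<in> set ds" for e
      using no_w[OF that] by (auto simp: ends_def)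
    moreover have "ends (a, w) \<noteq> ends (w, b)" using ab by (auto simp: ends_def doubleton_eq_iff)
    moreover have "subdivide_dart u v w d = [(a, w), (w, b)]"
      using True by (simp add: subdivide_dart_def d)
    ultimately show ?thesis using Cons.prems(1) tail by auto
  next
    case False
    have "ends d \<noteq> ends f" if "e \<in> set ds" "f \<in> set (subdivide_dart u v w e)" for e f
    proof -
      have "f = e \<or> f = (fst e, w) \<or> f = (w, snd e)"
        using that(2) by (cases "ends e = {u, v}") (simp_all add: subdivide_dart_def)
      then have "ends f = ends e \<or> w \<in> ends f" unfolding ends_def by fastforce
      moreover have "ends d \<noteq> ends e" using Cons.prems(1) that(1) by (auto simp: image_iff)
      moreover have "w \<notin> ends d" using ab d by (simp add: ends_def)
      ultimately show ?thesis by metis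
    qed
    then have "ends d \<notin> set (map ends (concat (map (subdivide_dart u v w) ds)))" by auto
    moreover have "subdivide_dart u v w d = [d]" using False by (simp add: subdivide_dart_def)
    ultimately show ?thesis using IH by simp
  qed
qed simp

lemma length_filter_distinct_map:
  "distinct (map f xs) \<Longrightarrow> y \<in> set (map f xs) \<Longrightarrow> length (filter (\<lambda>x. f x = y) xs) = 1"
proof (induction xs)
  case (Cons x xs)
  show ?case
  proof (cases "f x = y")
    case True
    then have "filter (\<lambda>x. f x = y) xs = []" using Cons.prems(1) by (simp add: filter_empty_conv) (metis imageI)
    then show ?thesis using True by simp
  qed (use Cons in auto)
qed simp

text \<open>The renaming identifies the new darts at \<open>u\<close> and \<open>v\<close> with
  those they replace, so the rotation there is the old one. At \<open>w\<close> the two darts are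
  exchanged and the walk passes straight through; since \<open>rot\<close> fixes every pair that is
  not a dart, the pairs starting at \<open>w\<close> reach the last transposition unchanged.\<close>

lemma face_walk_subdivide:
  assumes uv: "(u, v) \<in> A" "(v, u) \<in> A"
    and A: "\<And>a b. (a, b) \<in> A \<Longrightarrow> a \<noteq> b \<and> a \<noteq> w \<and> b \<noteq> w"
    and sym: "\<And>a b. (a, b) \<in> A \<Longrightarrow> (b, a) \<in> A"
    and fixed: "\<And>d. d \<notin> A \<Longrightarrow> rot d = d"
    and ds: "face_walk rot ds" "set ds \<subseteq> A"
  shows "face_walk (subdivide_rot rot (u, v) w) (concat (map (subdivide_dart u v w) ds))"
proof -
  let ?rot = "subdivide_rot rot (u, v) w" and ?E = "subdivide_dart u v w"
  have uvw: "u \<noteq> v" "u \<noteq> w" "v \<noteq> w" using A[OF uv(1)] by auto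
  have rot_w: "rot (w, x) = (w, x)" for x using A fixed by blast
  have mid: "face_succ ?rot (a, w) = (w, b)" if "{a, b} = {u, v}" for a b
    using that uvw rot_w by (auto simp: Let_def face_succ_def doubleton_eq_iff transpose_def)
  have step: "face_succ ?rot (last (?E d)) = hd (?E (face_succ rot d))"
    if d: "d \<in> A" "face_succ rot d \<in> A" for d
  proof -
    obtain a b where ab: "d = (a, b)" by force
    obtain a' b' where ab': "face_succ rot d = (a', b')" by force
    then have rot: "rot (b, a) = (a', b')" using ab by (simp add: face_succ_def)
    have neq: "a \<noteq> b" "a \<noteq> w" "b \<noteq> w" "a' \<noteq> b'" "a' \<noteq> w" "b' \<noteq> w"
      using A[of a b] A[of a' b'] d ab ab' by auto
    have hd: "hd (?E (a', b')) = (if {a', b'} = {u, v} then (a', w) else (a', b'))" by simp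
    \<comment> \<open>No old dart starts at \<open>w\<close>, so the transposition at
      \<open>w\<close> is idle and only the renaming acts.\<close>
    have outer: "transpose (w, u) (w, v) ((transpose (u, v) (u, w) \<circ> transpose (v, u) (v, w)) (a', b'))
        = hd (?E (a', b'))"
      using neq uvw unfolding hd by (auto simp: doubleton_eq_iff transpose_def)
    show ?thesis
    proof (cases "{a, b} = {u, v}")
      case True
      then have "(transpose (u, v) (u, w) \<circ> transpose (v, u) (v, w)) (b, w) = (b, a)"
        using uvw by (auto simp: doubleton_eq_iff transpose_def)
      then show ?thesis
        using True outer rot ab ab' by (simp add: Let_def face_succ_def)
    next
      case False
      then have "(transpose (u, v) (u, w) \<circ> transpose (v, u) (v, w)) (b, a) = (b, a)"
        using neq by (auto simp: transpose_def)
      then show ?thesis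
        using False outer rot ab ab' by (simp add: Let_def face_succ_def)
    qed
  qed
  have chain: "successively (\<lambda>d d'. face_succ ?rot d = d') (concat (map ?E xs))"
    if "successively (\<lambda>d d'. face_succ rot d = d') xs" "set xs \<subseteq> A" for xs
    using that
  proof (induction xs)
    case (Cons x xs)
    note prems = Cons.prems
    have "successively (\<lambda>d d'. face_succ ?rot d = d') (?E x)"
      using mid[of "fst x" "snd x"] by (simp add: subdivide_dart_def ends_def)
    moreover have "successively (\<lambda>d d'. face_succ ?rot d = d') (concat (map ?E xs))"
    proof (rule Cons.IH)
      show "successively (\<lambda>d d'. face_succ rot d = d') xs" using Cons.prems(1) by (cases xs) simp_all
      show "set xs \<subseteq> A" using Cons.prems(2) by simp
    qed
    moreover have "concat (map ?E xs) = [] \<or> face_succ ?rot (last (?E x)) = hd (concat (map ?E xs))"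
    proof (cases xs)
      case (Cons y ys)
      then have "face_succ rot x = y" "x \<in> A" "y \<in> A" using prems by auto
      then show ?thesis using step[of x] Cons by (simp del: subdivide_rot.simps)
    qed simp
    ultimately show ?case
      by (simp add: successively_append_iff del: subdivide_rot.simps)
  qed simp
  have ne: "ds \<noteq> []" using ds(1) by (simp add: face_walk_def)
  then have hd: "hd (concat (map ?E ds)) = hd (?E (hd ds))" and "concat (map ?E ds) \<noteq> []"
    by (cases ds; simp)+
  moreover have "successively (\<lambda>d d'. face_succ ?rot d = d') (concat (map ?E (ds @ [hd ds])))"
    using ds ne by (intro chain) (auto simp: face_walk_def)
  ultimately show ?thesis
    unfolding face_walk_def by (simp add: successively_append_iff del: subdivide_rot.simps)
qed

section \<open>Subdivided wheels as an invariant of edge subdivision\<close>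

definition wheel_edges ::
    "nat \<Rightarrow> 'a \<Rightarrow> (nat \<Rightarrow> 'a) \<Rightarrow> (nat \<Rightarrow> 'a list) \<Rightarrow> (nat \<Rightarrow> 'a list) \<Rightarrow> ('a \<times> 'a) list" where
  "wheel_edges n c r S R =
    concat (map (\<lambda>i. walk_darts c (S i) (r i) @ walk_darts (r i) (R i) (r (Suc i))) [0..<n])"

text \<open>
  \<open>S i\<close> lists the interior vertices of the spoke from \<open>c\<close> to \<open>r i\<close>, and \<open>R i\<close> those of the rim path
  from \<open>r i\<close> to \<open>r (i + 1)\<close>.
\<close>

definition subdivided_wheel ::
    "nat \<Rightarrow> 'a \<Rightarrow> (nat \<Rightarrow> 'a) \<Rightarrow> (nat \<Rightarrow> 'a list) \<Rightarrow> (nat \<Rightarrow> 'a list) \<Rightarrow>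
     'a pair_pre_digraph \<Rightarrow> ('a \<times> 'a \<Rightarrow> 'a \<times> 'a) \<Rightarrow> bool" where
  "subdivided_wheel n c r S R W rot \<longleftrightarrow>
     r n = r 0 \<and> S n = S 0 \<and>
     distinct (wheel_vertices n c r S R) \<and> pverts W = set (wheel_vertices n c r S R) \<and>
     distinct (map ends (wheel_edges n c r S R)) \<and>
     parcs W = set (wheel_edges n c r S R) \<union> prod.swap ` set (wheel_edges n c r S R) \<and>
     (\<forall>(a, b)\<in>parcs W. a \<noteq> b \<and> a \<in> pverts W \<and> b \<in> pverts W) \<and>
     (\<forall>d. d \<notin> parcs W \<longrightarrow> rot d = d) \<and>
     face_walk rot (walk_darts (r 0) (rim_path r R (n - 1)) (r 0)) \<and>
     (\<forall>i<n. face_walk rot (walk_darts c (inner_face r S R i) c))"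

lemma walk_darts_rim_path:
  "walk_darts (r 0) (rim_path r R k) (r (Suc k)) =
    concat (map (\<lambda>i. walk_darts (r i) (R i) (r (Suc i))) [0..<Suc k])"
  by (induction k) (auto simp: walk_darts_append)

lemma walk_darts_inner_face:
  "walk_darts c (inner_face r S R i) c =
    walk_darts c (S (Suc i)) (r (Suc i)) @
    rev (map prod.swap (walk_darts (r i) (R i) (r (Suc i)))) @
    rev (map prod.swap (walk_darts c (S i) (r i)))"
  by (simp add: inner_face_def walk_darts_append walk_darts_rev)

lemma set_wheel_edges:
  "set (wheel_edges n c r S R) =
    (\<Union>i<n. set (walk_darts c (S i) (r i)) \<union> set (walk_darts (r i) (R i) (r (Suc i))))"
  by (auto simp: wheel_edges_def)

lemma set_rim_darts:
  assumes "0 < n" "r n = r 0"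
  shows "set (walk_darts (r 0) (rim_path r R (n - 1)) (r 0)) =
    (\<Union>i<n. set (walk_darts (r i) (R i) (r (Suc i))))"
proof -
  have "r 0 = r (Suc (n - 1))" "Suc (n - 1) = n" using assms by simp_all
  then show ?thesis using walk_darts_rim_path[of r R "n - 1"] by (simp add: atLeast0LessThan)
qed

lemma inner_darts_subset:
  assumes "i < n" "r n = r 0" "S n = S 0"
  shows "set (walk_darts c (inner_face r S R i) c) \<subseteq>
    set (wheel_edges n c r S R) \<union> prod.swap ` set (wheel_edges n c r S R)"
proof -
  have spoke: "set (walk_darts c (S j) (r j)) \<subseteq> set (wheel_edges n c r S R)" if "j < n" for j
    unfolding set_wheel_edges using that by blast
  have "set (walk_darts c (S (Suc i)) (r (Suc i))) \<subseteq> set (wheel_edges n c r S R)"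
  proof (cases "Suc i = n")
    case True
    then show ?thesis using spoke[of 0] assms by simp
  next
    case False
    then show ?thesis using spoke[of "Suc i"] assms(1) by simp
  qed
  moreover have "set (walk_darts (r i) (R i) (r (Suc i))) \<subseteq> set (wheel_edges n c r S R)"
    unfolding set_wheel_edges using assms(1) by blast
  ultimately show ?thesis
    using spoke[OF assms(1)] by (auto simp: walk_darts_inner_face)
qed

text \<open>Outward darts of spoke \<open>i\<close> lie on face \<open>i - 1\<close>, inward ones on
  face \<open>i\<close>. Darts of \<open>R i\<close> in the order of the numbering lie on the outer
  face, the reversed ones on face \<open>i\<close>.\<close>

lemma dart_on_face:
  assumes n: "0 < n" "r n = r 0" "S n = S 0"
    and d: "d \<in> set (wheel_edges n c r S R) \<union> prod.swap ` set (wheel_edges n c r S R)"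
  shows "d \<in> set (walk_darts (r 0) (rim_path r R (n - 1)) (r 0)) \<or>
    (\<exists>i<n. d \<in> set (walk_darts c (inner_face r S R i) c))"
proof -
  consider i where "i < n" "d \<in> set (walk_darts c (S i) (r i))"
    | i where "i < n" "d \<in> set (walk_darts (r i) (R i) (r (Suc i)))"
    | i where "i < n" "d \<in> prod.swap ` set (walk_darts c (S i) (r i))"
    | i where "i < n" "d \<in> prod.swap ` set (walk_darts (r i) (R i) (r (Suc i)))"
    using d unfolding set_wheel_edges by blast
  then show ?thesis
  proof cases
    case (1 i)
    show ?thesis
    proof (cases i)
      case 0
      \<comment> \<open>Spoke 0 is also spoke \<open>n\<close>, so its outward darts bound face
        \<open>n - 1\<close>.\<close>
      then have "d \<in> set (walk_darts c (inner_face r S R (n - 1)) c)"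
        using 1 n by (simp add: walk_darts_inner_face)
      then show ?thesis using n(1) by (metis diff_less zero_less_one)
    next
      case (Suc j)
      then have "d \<in> set (walk_darts c (inner_face r S R j) c)"
        using 1 by (simp add: walk_darts_inner_face)
      then show ?thesis using 1 Suc by (metis Suc_lessD)
    qed
  next
    case (2 i)
    then show ?thesis using set_rim_darts[of n r R] n by blast
  next
    case (3 i)
    then have "d \<in> set (walk_darts c (inner_face r S R i) c)"
      by (simp add: walk_darts_inner_face)
    then show ?thesis using 3(1) by blast
  next
    case (4 i)
    then have "d \<in> set (walk_darts c (inner_face r S R i) c)"
      by (simp add: walk_darts_inner_face)
    then show ?thesis using 4(1) by blast
  qed
qed

text \<open>Each spoke and rim path absorbs \<open>w\<close> where it traverses \<open>uv\<close>.
  Every edge being listed once, exactly one of them does so, and the vertices stay distinct. The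
  clauses of \<open>subdivided_wheel\<close> on edges, loops and fixed pairs are carried along
  because this step consumes them.\<close>

lemma subdivided_wheel_divide:
  assumes sw: "subdivided_wheel n c r S R W rot"
    and e: "e \<in> parcs W" and w: "w \<notin> pverts W" and n: "0 < n"
  shows "\<exists>S' R'. subdivided_wheel n c r S' R' (subdivide W e w) (subdivide_rot rot e w)"
proof -
  obtain u v where uv: "e = (u, v)" by force
  have rS: "r n = r 0" "S n = S 0"
    and V: "distinct (wheel_vertices n c r S R)" "pverts W = set (wheel_vertices n c r S R)"
    and E: "distinct (map ends (wheel_edges n c r S R))"
      "parcs W = set (wheel_edges n c r S R) \<union> prod.swap ` set (wheel_edges n c r S R)"
    and wf: "\<And>a b. (a, b) \<in> parcs W \<Longrightarrow> a \<noteq> b \<and> a \<in> pverts W \<and> b \<in> pverts W"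
    and fixed: "\<And>d. d \<notin> parcs W \<Longrightarrow> rot d = d"
    and rim: "face_walk rot (walk_darts (r 0) (rim_path r R (n - 1)) (r 0))"
    and inner: "\<And>i. i < n \<Longrightarrow> face_walk rot (walk_darts c (inner_face r S R i) c)"
    using sw unfolding subdivided_wheel_def by (elim conjE; fast)+
  define S' where "S' i = subdivide_path u v w c (S i) (r i)" for i
  define R' where "R' i = subdivide_path u v w (r i) (R i) (r (Suc i))" for i
  let ?D = "subdivide_dart u v w"
  let ?E = "wheel_edges n c r S R" and ?E' = "wheel_edges n c r S' R'"
  let ?V = "wheel_vertices n c r S R" and ?V' = "wheel_vertices n c r S' R'"
  have sym: "(b, a) \<in> parcs W" if "(a, b) \<in> parcs W" for a b
    using that unfolding E(2) by force
  have uvW: "(u, v) \<in> parcs W" "(v, u) \<in> parcs W" using e uv sym by auto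
  have uv': "u \<noteq> v" "u \<noteq> w" "v \<noteq> w" using wf[OF uvW(1)] w by auto
  have wf': "a \<noteq> b \<and> a \<noteq> w \<and> b \<noteq> w" if "(a, b) \<in> parcs W" for a b
    using wf[OF that] w by auto
  have E': "?E' = concat (map ?D ?E)"
  proof -
    have "wheel_edges k c r S' R' = concat (map ?D (wheel_edges k c r S R))" for k
      by (induction k) (simp_all add: wheel_edges_def S'_def R'_def walk_darts_subdivide)
    then show ?thesis .
  qed
  have "{u, v} \<in> set (map ends ?E)"
  proof -
    have "(u, v) \<in> set ?E \<or> (v, u) \<in> set ?E" using uvW(1) unfolding E(2) by auto
    then show ?thesis by (force simp: ends_def insert_commute)
  qed
  then have once: "length (filter (\<lambda>d. ends d = {u, v}) ?E) = 1"
    by (rule length_filter_distinct_map[OF E(1)])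
  have plus: "replicate_mset (k + l) w = replicate_mset k w + replicate_mset l w" for k l
    by (rule multiset_eqI) simp
  \<comment> \<open>The copies of \<open>w\<close> are counted along prefixes of the index list; for
    \<open>k = n\<close> there is exactly one.\<close>
  have "mset (concat (map (\<lambda>i. S' i @ r i # R' i) [0..<k])) =
      mset (concat (map (\<lambda>i. S i @ r i # R i) [0..<k])) +
      replicate_mset (length (filter (\<lambda>d. ends d = {u, v}) (wheel_edges k c r S R))) w" for k
    by (induction k)
      (simp_all add: S'_def R'_def wheel_edges_def mset_subdivide_path plus)
  then have "mset ?V' = mset (w # ?V)"
    unfolding wheel_vertices_def using once by simp
  then have V': "set ?V' = insert w (set ?V)" "distinct ?V'"
    using V w mset_eq_setD[of ?V' "w # ?V"] mset_eq_imp_distinct_iff[of ?V' "w # ?V"] by auto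
  have distE': "distinct (map ends ?E')"
    unfolding E' using E(1)
  proof (rule distinct_ends_subdivide)
    fix a b assume "(a, b) \<in> set ?E"
    then show "a \<noteq> b \<and> a \<noteq> w \<and> b \<noteq> w" using wf' unfolding E(2) by blast
  qed
  have parcs': "parcs (subdivide W e w) =
      (parcs W - {(u, v), (v, u)}) \<union> {(u, w), (w, u), (w, v), (v, w)}"
    unfolding uv by (auto simp: subdivide.simps)
  have "(\<Union>d\<in>parcs W. set (?D d)) = set ?E' \<union> prod.swap ` set ?E'"
    unfolding E' E(2) by (auto simp: subdivide_dart_swap image_Union image_image)
  moreover have "(\<Union>d\<in>parcs W. set (?D d)) =
      (parcs W - {(u, v), (v, u)}) \<union> {(u, w), (w, u), (w, v), (v, w)}"
  proof (intro equalityI subsetI)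
    fix x assume "x \<in> (\<Union>d\<in>parcs W. set (?D d))"
    then obtain a b where ab: "(a, b) \<in> parcs W" "x \<in> set (?D (a, b))" by auto
    show "x \<in> (parcs W - {(u, v), (v, u)}) \<union> {(u, w), (w, u), (w, v), (v, w)}"
    proof (cases "{a, b} = {u, v}")
      case True
      then show ?thesis using ab(2) by (auto simp: doubleton_eq_iff)
    next
      case False
      then show ?thesis using ab by (auto simp: doubleton_eq_iff)
    qed
  next
    fix x assume "x \<in> (parcs W - {(u, v), (v, u)}) \<union> {(u, w), (w, u), (w, v), (v, w)}"
    then consider "x \<in> parcs W" "x \<noteq> (u, v)" "x \<noteq> (v, u)" | "x \<in> {(u, w), (w, v)}"
      | "x \<in> {(v, w), (w, u)}" by blast
    then show "x \<in> (\<Union>d\<in>parcs W. set (?D d))"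
    proof cases
      case 1
      then have "?D x = [x]" by (auto simp: subdivide_dart_def ends_def doubleton_eq_iff prod_eq_iff)
      then show ?thesis using 1 by force
    next
      case 2
      then have "x \<in> set (?D (u, v))" by auto
      then show ?thesis using uvW(1) by blast
    next
      case 3
      then have "x \<in> set (?D (v, u))" by (auto simp: insert_commute)
      then show ?thesis using uvW(2) by blast
    qed
  qed
  ultimately have parcsE': "parcs (subdivide W e w) = set ?E' \<union> prod.swap ` set ?E'"
    using parcs' by simp
  have wfW': "\<forall>(a, b)\<in>parcs (subdivide W e w).
      a \<noteq> b \<and> a \<in> pverts (subdivide W e w) \<and> b \<in> pverts (subdivide W e w)"
    unfolding parcs' verts_subdivide using wf uv' wf[OF uvW(1)] by auto
  have fixed': "subdivide_rot rot e w d = d" if "d \<notin> parcs (subdivide W e w)" for d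
  proof -
    have d: "d \<notin> {(u, w), (w, u), (w, v), (v, w)}" "d \<in> {(u, v), (v, u)} \<or> d \<notin> parcs W"
      using that unfolding parcs' by auto
    have "(u, w) \<notin> parcs W" "(v, w) \<notin> parcs W" using wf' by blast+
    then have "rot (u, w) = (u, w)" "rot (v, w) = (v, w)" using fixed by auto
    moreover have "d \<notin> {(u, v), (v, u)} \<Longrightarrow> rot d = d" using d fixed by blast
    ultimately show ?thesis
      using d(1) uv' unfolding uv by (auto simp: Let_def transpose_def)
  qed
  have face: "face_walk (subdivide_rot rot e w) (walk_darts a (subdivide_path u v w a K a) a)"
    if "face_walk rot (walk_darts a K a)" "set (walk_darts a K a) \<subseteq> parcs W" for a K
    unfolding walk_darts_subdivide uv
    by (rule face_walk_subdivide[where A = "parcs W"]) (use uvW wf' sym fixed that in auto)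
  have rim_path': "rim_path r R' k = subdivide_path u v w (r 0) (rim_path r R k) (r (Suc k))" for k
    by (induction k) (simp_all add: R'_def subdivide_path_append)
  \<comment> \<open>The general formula ends at \<open>r (Suc k)\<close>; for
    \<open>k = n - 1\<close> this is \<open>r 0\<close>, which closes the walk.\<close>
  have "r 0 = r (Suc (n - 1))" using rS n by simp
  then have "rim_path r R' (n - 1) = subdivide_path u v w (r 0) (rim_path r R (n - 1)) (r 0)"
    using rim_path' by metis
  moreover have "set (walk_darts (r 0) (rim_path r R (n - 1)) (r 0)) \<subseteq> parcs W"
    unfolding E(2) set_rim_darts[OF n rS(1)] set_wheel_edges by blast
  ultimately have rim': "face_walk (subdivide_rot rot e w) (walk_darts (r 0) (rim_path r R' (n - 1)) (r 0))"
    using face[OF rim] by simp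
  have inner': "face_walk (subdivide_rot rot e w) (walk_darts c (inner_face r S' R' i) c)"
    if "i < n" for i
  proof -
    have "inner_face r S' R' i = subdivide_path u v w c (inner_face r S R i) c"
      by (simp add: inner_face_def S'_def R'_def subdivide_path_append subdivide_path_rev)
    then show ?thesis
      using face[OF inner[OF that]] inner_darts_subset[OF that rS, of c R] E(2) by simp
  qed
  have "S' n = S' 0" by (simp add: S'_def rS)
  then have "subdivided_wheel n c r S' R' (subdivide W e w) (subdivide_rot rot e w)"
    unfolding subdivided_wheel_def
    using rS V' V(2) distE' parcsE' wfW' fixed' rim' inner' verts_subdivide[of W e w]
    by (intro conjI) simp_all
  then show ?thesis by blast
qed

section \<open>The wheel before any subdivision\<close>

lemma distinct_concat_uptI:
  assumes "\<And>i. i < n \<Longrightarrow> distinct (f i)"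
    and "\<And>i j. i < j \<Longrightarrow> j < n \<Longrightarrow> set (f i) \<inter> set (f j) = {}"
  shows "distinct (concat (map f [0..<n]))"
  using assms
proof (induction n)
  case (Suc n)
  have "(\<Union>i<n. set (f i)) \<inter> set (f n) = {}" using Suc.prems(2) by blast
  then show ?case using Suc by (simp add: atLeast0LessThan)
qed simp

lemma successively_upt:
  "(\<And>i. Suc i < n \<Longrightarrow> P i (Suc i)) \<Longrightarrow> successively P [0..<n]"
proof (induction n)
  case (Suc n)
  then have IH: "successively P [0..<n]" by simp
  show ?case
  proof (cases n)
    case m: (Suc m)
    then have "P (last [0..<n]) n" using Suc.prems[of m] by simp
    then have "successively P ([0..<n] @ [n])" unfolding successively_append_iff using IH by simp
    then show ?thesis by simp
  qed simp
qed simp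

lemma subdivided_wheel_base:
  assumes n: "3 \<le> n" and pw: "plane_wheel n G rot"
  shows "\<exists>c r. subdivided_wheel n c r (\<lambda>_. []) (\<lambda>_. []) G rot"
proof -
  obtain c s where s: "inj_on s {..<n}" "c \<notin> s ` {..<n}" "G = wheel_graph n c s" "rot permutes parcs G"
    and rot: "\<forall>i<n. let next_r = s (Suc i mod n); prev_r = s ((i + n - 1) mod n) in
        rot (c, s i) = (c, next_r) \<and> rot (s i, next_r) = (s i, c) \<and>
        rot (s i, c) = (s i, prev_r) \<and> rot (s i, prev_r) = (s i, next_r)"
    using pw unfolding plane_wheel_def by blast
  \<comment> \<open>The rim is extended periodically, which gives \<open>r n = r 0\<close> and
    successors without reduction modulo \<open>n\<close>.\<close>
  define r where "r i = s (i mod n)" for i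
  have r_eq: "r i = r j \<longleftrightarrow> i mod n = j mod n" for i j
    using s(1) n unfolding r_def by (subst inj_on_eq_iff[OF s(1)]) auto
  have rc: "r i \<noteq> c" for i using s(2) n unfolding r_def by force
  have r_Suc: "s (Suc (i mod n) mod n) = r (Suc i)" for i by (simp add: r_def mod_Suc_eq)
  have rot_c: "rot (c, r i) = (c, r (Suc i))" for i
    using rot[rule_format, of "i mod n"] n by (simp add: Let_def r_Suc r_def[of i])
  have rot_next: "rot (r i, r (Suc i)) = (r i, c)" for i
    using rot[rule_format, of "i mod n"] n by (simp add: Let_def r_Suc r_def[of i])
  have prev: "s ((Suc i mod n + n - 1) mod n) = r i" for i
  proof -
    have "(Suc i mod n + n - 1) mod n = (Suc i mod n + (n - 1)) mod n" using n by simp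
    also have "\<dots> = (Suc i + (n - 1)) mod n" by (rule mod_add_left_eq)
    also have "\<dots> = i mod n" using n by simp
    finally show ?thesis by (simp add: r_def)
  qed
  have rot_spoke: "rot (r (Suc i), c) = (r (Suc i), r i)" for i
    using rot[rule_format, of "Suc i mod n"] n by (simp only: Let_def prev r_def[of "Suc i"]) simp
  have rot_prev: "rot (r (Suc i), r i) = (r (Suc i), r (Suc (Suc i)))" for i
    using rot[rule_format, of "Suc i mod n"] n
    by (simp only: Let_def prev r_def[of "Suc i"] r_Suc) simp
  let ?N = "\<lambda>_::nat. [] :: 'a list"
  have V: "wheel_vertices n c r ?N ?N = c # map r [0..<n]"
    by (simp add: wheel_vertices_def)
  have rimg: "r ` {..<n} = s ` {..<n}" by (intro image_cong) (auto simp: r_def)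
  have setV: "pverts G = set (wheel_vertices n c r ?N ?N)"
    unfolding V s(3) wheel_graph_def using rimg by (simp add: atLeast0LessThan)
  have distV: "distinct (wheel_vertices n c r ?N ?N)"
    unfolding V using rc by (auto simp: distinct_map inj_on_def r_eq)
  have Ed: "wheel_edges n c r ?N ?N = concat (map (\<lambda>i. [(c, r i), (r i, r (Suc i))]) [0..<n])"
    by (simp add: wheel_edges_def)
  have distE: "distinct (map ends (wheel_edges n c r ?N ?N))"
  proof -
    have "distinct (concat (map (\<lambda>i. [{c, r i}, {r i, r (Suc i)}]) [0..<n]))"
    proof (rule distinct_concat_uptI)
      show "distinct [{c, r i}, {r i, r (Suc i)}]" if "i < n" for i
        using rc by (auto simp: doubleton_eq_iff)
      fix i j assume ij: "i < j" "j < n"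
      have "r i \<noteq> r j" using ij by (simp add: r_eq)
      \<comment> \<open>Rim edges with different starting points could coincide only in opposite
        directions, and then \<open>n\<close> would divide 2.\<close>
      moreover have "\<not> (r i = r (Suc j) \<and> r (Suc i) = r j)"
      proof
        assume *: "r i = r (Suc j) \<and> r (Suc i) = r j"
        then have "Suc i = j" using ij by (simp add: r_eq)
        moreover have "i = Suc j mod n" using * ij by (simp add: r_eq)
        ultimately show False using ij n by (cases "Suc j = n") auto
      qed
      ultimately show "set [{c, r i}, {r i, r (Suc i)}] \<inter> set [{c, r j}, {r j, r (Suc j)}] = {}"
        using rc by (auto simp: doubleton_eq_iff)
    qed
    then show ?thesis unfolding Ed by (simp add: map_concat comp_def ends_def)
  qed
  have parcsG: "parcs G = set (wheel_edges n c r ?N ?N) \<union> prod.swap ` set (wheel_edges n c r ?N ?N)"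
  proof -
    have "parcs G = (\<Union>i<n. {(c, r i), (r i, c), (r i, r (Suc i)), (r (Suc i), r i)})"
      unfolding s(3) wheel_graph_def by (auto simp: r_def)
    also have "\<dots> = set (wheel_edges n c r ?N ?N) \<union> prod.swap ` set (wheel_edges n c r ?N ?N)"
      unfolding set_wheel_edges by (auto simp: image_Union)
    finally show ?thesis .
  qed
  have wf: "\<forall>(a, b)\<in>parcs G. a \<noteq> b \<and> a \<in> pverts G \<and> b \<in> pverts G"
  proof -
    have rr: "r i \<noteq> r (Suc i)" for i
      using n by (auto simp: r_eq mod_Suc split: if_splits)
    have rin: "r i \<in> pverts G" for i
      unfolding s(3) wheel_graph_def r_def using n by auto
    have cin: "c \<in> pverts G" unfolding s(3) wheel_graph_def by simp
    have "a \<noteq> b \<and> a \<in> pverts G \<and> b \<in> pverts G" if ab: "(a, b) \<in> parcs G" for a b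
    proof -
      obtain i where "(a, b) \<in> {(c, r i), (r i, c), (r i, r (Suc i)), (r (Suc i), r i)}"
        using ab unfolding parcsG set_wheel_edges by fastforce
      then show ?thesis using rr[of i] rin rc[of i] cin by (elim insertE) simp_all
    qed
    then show ?thesis by blast
  qed
  have inner: "face_walk rot (walk_darts c (inner_face r ?N ?N i) c)" for i
    by (simp add: inner_face_def face_walk_def face_succ_def rot_c rot_next rot_spoke)
  have rim: "face_walk rot (walk_darts (r 0) (rim_path r ?N (n - 1)) (r 0))"
  proof -
    have r0: "r 0 = r (Suc (n - 1))" "r 1 = r (Suc n)" using n by (simp_all add: r_def mod_Suc)
    have "walk_darts (r 0) (rim_path r ?N (n - 1)) (r 0) = map (\<lambda>i. (r i, r (Suc i))) [0..<n]"
      using walk_darts_rim_path[of r ?N "n - 1"] r0 n by simp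
    \<comment> \<open>The closing dart is the term of index \<open>n\<close>, so the closed list is
      the same map over one more index.\<close>
    moreover have "hd (map (\<lambda>i. (r i, r (Suc i))) [0..<n]) = (r n, r (Suc n))"
      using r0 n by (simp add: hd_map)
    ultimately have "walk_darts (r 0) (rim_path r ?N (n - 1)) (r 0) @
        [hd (walk_darts (r 0) (rim_path r ?N (n - 1)) (r 0))] =
        map (\<lambda>i. (r i, r (Suc i))) [0..<Suc n]"
      by simp
    moreover have "successively (\<lambda>d d'. face_succ rot d = d') (map (\<lambda>i. (r i, r (Suc i))) [0..<Suc n])"
      unfolding successively_map by (rule successively_upt) (simp add: face_succ_def rot_prev)
    moreover have "walk_darts (r 0) (rim_path r ?N (n - 1)) (r 0) \<noteq> []"
      by (metis map_fst_walk_darts list.discI list.simps(8))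
    ultimately show ?thesis unfolding face_walk_def by argo
  qed
  have "r n = r 0" by (simp add: r_def)
  moreover have "\<forall>d. d \<notin> parcs G \<longrightarrow> rot d = d" using s(4) permutes_not_in by metis
  ultimately have "subdivided_wheel n c r ?N ?N G rot"
    unfolding subdivided_wheel_def
    using distV setV distE parcsG wf rim inner by (intro conjI) blast+
  then show ?thesis by blast
qed

lemma plane_subdivision_subdivided_wheel:
  assumes "plane_subdivision G rotG W rotW" "3 \<le> n" "plane_wheel n G rotG"
  shows "\<exists>c r S R. subdivided_wheel n c r S R W rotW"
  using assms(1)
proof induction
  case base
  then show ?case using subdivided_wheel_base[OF assms(2,3)] by blast
next
  case (divide H rotH e w)
  then show ?case using subdivided_wheel_divide assms(2) by (metis gr0I not_numeral_le_zero)
qed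

theorem theorem7:
  fixes n :: nat
    and G W :: "'a pair_pre_digraph"
    and rotG rotW :: "'a \<times> 'a \<Rightarrow> 'a \<times> 'a"
  assumes "n \<ge> 3"
    and "plane_wheel n G rotG"
    and "plane_graph W rotW"
    and "plane_subdivision G rotG W rotW"
  shows "pi_fl W rotW \<le> 8"
proof -
  obtain c r S R where sw: "subdivided_wheel n c r S R W rotW"
    using plane_subdivision_subdivided_wheel[OF assms(4,1,2)] by blast
  note sw = sw[unfolded subdivided_wheel_def]
  have n: "2 \<le> n" "0 < n" using assms(1) by simp_all
  have rS: "r n = r 0" "S n = S 0" and V: "distinct (wheel_vertices n c r S R)"
    and E: "parcs W = set (wheel_edges n c r S R) \<union> prod.swap ` set (wheel_edges n c r S R)"
    using sw by blast+
  interpret wheel_lists n c r S R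
    by (rule wheel_lists.intro) (fact n rS V)+
  have "facially_nonrepetitively_choosable W rotW 8"
    unfolding facially_nonrepetitively_choosable_def
  proof (intro allI impI)
    fix L :: "'a \<Rightarrow> nat set"
    assume L: "\<forall>v\<in>pverts W. L v \<subseteq> {1..} \<and> (infinite (L v) \<or> 8 \<le> card (L v))"
    have pverts: "pverts W = set (wheel_vertices n c r S R)" using sw by blast
    have "at_least 8 (L v)" if "v \<in> set (wheel_vertices n c r S R)" for v
      using L that unfolding pverts at_least_def by blast
    then obtain \<phi> where \<phi>: "\<forall>v\<in>pverts W. \<phi> v \<in> L v"
      and rim: "\<phi> (r 0) \<notin> \<phi> ` set (rim_path r R (n - 1))" "nonrep (map \<phi> (rim_path r R (n - 1)))"
      and inner: "\<forall>i<n. \<phi> c \<notin> \<phi> ` set (inner_face r S R i) \<and> nonrep (map \<phi> (inner_face r S R i))"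
      using wheel_list_colouring unfolding pverts by blast
    have "facial_nonrepetitive W rotW \<phi>"
    proof (rule facial_nonrepetitiveI)
      fix d assume "d \<in> parcs W"
      then have "d \<in> set (walk_darts (r 0) (rim_path r R (n - 1)) (r 0)) \<or>
          (\<exists>i<n. d \<in> set (walk_darts c (inner_face r S R i) c))"
        unfolding E by (rule dart_on_face[OF n(2) rS])
      moreover have "face_walk rotW (walk_darts (r 0) (rim_path r R (n - 1)) (r 0))"
        "\<forall>i<n. face_walk rotW (walk_darts c (inner_face r S R i) c)"
        using sw by blast+
      ultimately show "\<exists>a K. d \<in> set (walk_darts a K a) \<and> face_walk rotW (walk_darts a K a) \<and>
          \<phi> a \<notin> \<phi> ` set K \<and> nonrep (map \<phi> K)"
        using rim inner by blast
    qed
    then show "\<exists>\<phi>. (\<forall>v\<in>pverts W. \<phi> v \<in> L v) \<and> facial_nonrepetitive W rotW \<phi>"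
      using \<phi> by blast
  qed
  then show ?thesis unfolding pi_fl_def by (rule Least_le)
qed

end
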